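(* The capacity of the BC-OIC is lower-bounded as $$\mathsf{C}_{\mathrm B}(\mathbf{h},\boldsymbol{\alpha},\sigma)\ge\frac12\log\left(1+\frac{\exp(2\gamma_{\mathrm B})}{2\pi e\sigma^2}\right),$$ where $$\gamma_{\mathrm B}=\min_{\substack{\nu_0\in\mathbb{R}\\ \lambda_0,\lambda_1,\dots,\lambda_{n-1}\ge0}}\ \sum_{i=0}^{n-1}\lambda_i(1-\mathsf{H}_{[i]})\bar\alpha_i-1-\nu_0+e^{\nu_0}\left\{\sum_{k=1}^n h_k\exp\left[-\lambda_0\mathsf{H}_{[k-1]}+\sum_{i=1}^{k-2}\lambda_i\big(\mathsf{H}_{[i]}-\mathsf{H}_{[k-1]}\big)\right]\zeta\left[\left(-\sum_{i=0}^{k-1}\lambda_i\right)h_k\right]\right\}$$ with $\zeta(x)=\frac{e^x-1}{x}$ (and $\zeta(0)=1$).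
   Context: Let $n\ge 2$ be an integer, $\mathbf{h}=(h_1,\dots,h_n)^{\mathsf T}$ with $h_k>0$ and $\sum_{k=1}^n h_k=1$, and $\boldsymbol{\alpha}=(\alpha_1,\dots,\alpha_n)^{\mathsf T}$ with $1\ge\alpha_1>\alpha_2>\cdots>\alpha_n>0$ and $\alpha_n\le \tfrac12$. Put $\mathsf{H}_{[0]}=0$, $\mathsf{H}_{[k]}=\sum_{i=1}^k h_i$ and $\bar\alpha_k=\frac{\sum_{i=k+1}^n h_i\alpha_i}{1-\mathsf{H}_{[k]}}$ for $0\le k\le n-1$. Empty sums are $0$. Channel: $Y=\mathbf{h}^{\mathsf T}\mathbf{X}+Z$ with $Z\sim\mathcal{N}(0,\sigma^2)$, $\sigma>0$, independent of $\mathbf{X}=(X_1,\dots,X_n)^{\mathsf T}$. The BC-OIC capacity is $\mathsf{C}_{\mathrm B}(\mathbf{h},\boldsymbol{\alpha},\sigma)=\sup I(\mathbf{X};Y)$, the supremum being over all laws of $\mathbf{X}$ with $0\le X_k\le1$ (almost surely) and $\mathbb{E}[X_k]\le\alpha_k$ for all $k\in\{1,\dots,n\}$. $I$ is mutual information in nats; $\log$ is the natural logarithm. *)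

theory Defs
  imports "HOL-Probability.Probability"
begin

definition cum_gain :: "(nat \<Rightarrow> real) \<Rightarrow> nat \<Rightarrow> real" where
  "cum_gain h k = (\<Sum>i=1..k. h i)"

definition abar :: "nat \<Rightarrow> (nat \<Rightarrow> real) \<Rightarrow> (nat \<Rightarrow> real) \<Rightarrow> nat \<Rightarrow> real" where
  "abar n h \<alpha> k = (\<Sum>i=k+1..n. h i * \<alpha> i) / (1 - cum_gain h k)"

(* Vectors (x_1, ..., x_n) are the points of the product space over the index set {1..n};
   entries of h, alpha and lambda outside the relevant index range are never used. *)

abbreviation input_space :: "nat \<Rightarrow> (nat \<Rightarrow> real) measure" where
  "input_space n \<equiv> Pi\<^sub>M {1..n} (\<lambda>_. borel)"

definition gaussian_noise :: "real \<Rightarrow> real measure" where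
  "gaussian_noise \<sigma> = density lborel (\<lambda>z. ennreal (normal_density 0 \<sigma> z))"

definition channel_output ::
    "nat \<Rightarrow> (nat \<Rightarrow> real) \<Rightarrow> (nat \<Rightarrow> real) \<times> real \<Rightarrow> real" where
  "channel_output n h = (\<lambda>(x, z). (\<Sum>k=1..n. h k * x k) + z)"

(* I(X; Y) in nats (base e) when X has law P: the product measure makes X and Z independent.
   For the laws in admissible_laws and sigma > 0 the input is bounded, so the joint law of (X, Y)
   is absolutely continuous with respect to the product of its marginals and the information
   density is integrable; the library's mutual information is then the usual one. *)
definition channel_information ::
    "nat \<Rightarrow> (nat \<Rightarrow> real) \<Rightarrow> real \<Rightarrow> (nat \<Rightarrow> real) measure \<Rightarrow> real" where
  "channel_information n h \<sigma> P =
     prob_space.mutual_information (P \<Otimes>\<^sub>M gaussian_noise \<sigma>) (exp 1)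
       (input_space n) borel fst (channel_output n h)"

definition admissible_laws :: "nat \<Rightarrow> (nat \<Rightarrow> real) \<Rightarrow> (nat \<Rightarrow> real) measure set" where
  "admissible_laws n \<alpha> =
     {P. prob_space P \<and> sets P = sets (input_space n) \<and>
         (\<forall>k\<in>{1..n}. (AE x in P. 0 \<le> x k \<and> x k \<le> 1) \<and> (\<integral>x. x k \<partial>P) \<le> \<alpha> k)}"

(* Extended real, so that the supremum needs no boundedness assumption. *)
definition bc_oic_capacity ::
    "nat \<Rightarrow> (nat \<Rightarrow> real) \<Rightarrow> (nat \<Rightarrow> real) \<Rightarrow> real \<Rightarrow> ereal" where
  "bc_oic_capacity n h \<alpha> \<sigma> =
     (SUP P \<in> admissible_laws n \<alpha>. ereal (channel_information n h \<sigma> P))"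

definition zeta_fn :: "real \<Rightarrow> real" where
  "zeta_fn x = (if x = 0 then 1 else (exp x - 1) / x)"

(* For k = 1 the index range {1..k - 2} is empty also under truncated subtraction. *)
definition gamma_objective ::
    "nat \<Rightarrow> (nat \<Rightarrow> real) \<Rightarrow> (nat \<Rightarrow> real) \<Rightarrow> real \<Rightarrow> (nat \<Rightarrow> real) \<Rightarrow> real" where
  "gamma_objective n h \<alpha> \<nu> lam =
     (\<Sum>i=0..n-1. lam i * (1 - cum_gain h i) * abar n h \<alpha> i) - 1 - \<nu>
     + exp \<nu> * (\<Sum>k=1..n. h k
         * exp (- lam 0 * cum_gain h (k - 1)
                + (\<Sum>i=1..k-2. lam i * (cum_gain h i - cum_gain h (k - 1))))
         * zeta_fn ((- (\<Sum>i=0..k-1. lam i)) * h k))"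

definition gamma_values :: "nat \<Rightarrow> (nat \<Rightarrow> real) \<Rightarrow> (nat \<Rightarrow> real) \<Rightarrow> real set" where
  "gamma_values n h \<alpha> =
     {gamma_objective n h \<alpha> \<nu> lam | \<nu> lam. \<forall>i\<in>{0..n-1}. 0 \<le> lam i}"

(* Infimum of the objective; that it is attained, i.e. a minimum, has to be shown. *)
definition gamma_B :: "nat \<Rightarrow> (nat \<Rightarrow> real) \<Rightarrow> (nat \<Rightarrow> real) \<Rightarrow> real" where
  "gamma_B n h \<alpha> = Inf (gamma_values n h \<alpha>)"

end

(* The dual problem has an optimiser lambda, since every constraint leaves slack (alpha_n > 0). With
   H_i = cum_gain h i, the Gibbs density f(s) proportional to exp(- sum_i lambda_i max(0, s - H_i))
   on [0,1] then satisfies, by the KKT conditions, E max(0, S - H_i) <= sum_{k>i} h_k alpha_k, and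
   its entropy is gamma_B. Filling the coordinates of X in the order 1, ..., n until
   h^T X = S gives E max(0, S - H_i) = sum_{k>i} h_k E X_k, so only the tail sums of the means are
   controlled; as alpha is decreasing, weighted transfers between coordinates, which preserve
   h^T X = S and the cube, bring every single mean below alpha_k.

   The claim is then the entropy power inequality for S + Z with Z Gaussian, proved by transport:
   write S = T(A) with A standard normal and T increasing, and rotate (A, Z / sigma) to (U, V). For
   fixed V the map U |-> T(A) + Z is increasing with derivative c T'(A) + sigma r, where
   (c, r) is the unit vector of the rotation, so Gibbs' inequality and concavity of ln
   bound the entropy of S + Z from below; c : r = exp(h(S)) / sqrt(2 pi e) : sigma is optimal. *)

theory Submission
  imports Defs
begin

text \<open>The formula for \<open>gamma_B\<close> is a Lagrange dual: entropy on [0,1] is maximised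
  under upper bounds on E max(0, S - H_i). The penalty is affine between consecutive H_k, so
  integrating its exponential piece by piece produces the \<open>zeta_fn\<close> terms, and
  minimising over \<nu> turns the normalising integral into its logarithm. The bounds on E max(0, S
  - H_i) are necessary for the constraints on the means, because S - H_i is at most the sum of h_k
  X_k over k > i; that they also suffice is what the allocation shows.

  Mutual information is handled as the mean of a log-likelihood ratio, not as a difference of
  entropies, so the input needs no density. On [0,1] the Gibbs density is bounded away from 0 and
  from infinity, hence every logarithm in the transport argument grows at most quadratically and
  integrability reduces to second Gaussian moments. The change of variables is needed only as an
  inequality, so the range of the map need not be determined. The KKT conditions come from moving
  one multiplier with a quadratic error term, which avoids differentiating under the
  integral.\<close>

section \<open>Transport from the standard normal law\<close>

text \<open>Continuity is asked for only on an interval around \<open>x\<close>, because the law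
  transported below has a density that jumps at 0 and 1. On such an interval the cdf differs from an
  antiderivative of \<open>f\<close> by a constant.\<close>

lemma has_real_derivative_cdf_density:
  fixes f :: "real \<Rightarrow> real"
  assumes M: "real_distribution (density lborel (\<lambda>x. ennreal (f x)))"
    and f: "f \<in> borel_measurable borel" "\<And>x. 0 \<le> f x"
    and cont: "\<And>x. u < x \<Longrightarrow> x < w \<Longrightarrow> isCont f x" and x: "u < x" "x < w"
  shows "(cdf (density lborel (\<lambda>x. ennreal (f x))) has_real_derivative f x) (at x)"
proof -
  let ?M = "density lborel (\<lambda>x. ennreal (f x))"
  interpret real_distribution ?M by fact
  obtain G where G: "\<And>y. u < y \<Longrightarrow> y < w \<Longrightarrow> (G has_real_derivative f y) (at y)"
    using einterval_antiderivative[of "ereal u" "ereal w" f] cont x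
    by (auto simp: has_real_derivative_iff_has_vector_derivative)
  obtain p where p: "u < p" "p < x" using dense x by blast
  have eq: "cdf ?M y = cdf ?M p + (G y - G p)" if y: "p < y" "y < w" for y
  proof -
    have "emeasure ?M {p<..y} = (\<integral>\<^sup>+s. ennreal (f s) * indicator {p<..y} s \<partial>lborel)"
      using f by (intro emeasure_density) auto
    also have "\<dots> = (\<integral>\<^sup>+s. ennreal (f s) * indicator {p..y} s \<partial>lborel)"
      by (intro nn_integral_cong_AE AE_I[where N="{p}"]) (auto simp: indicator_def)
    also have "\<dots> = ennreal (G y - G p)"
      using f p y G by (intro nn_integral_FTC_Icc) (auto intro: has_field_derivative_at_within)
    finally have "emeasure ?M {p<..y} = ennreal (G y - G p)" .
    moreover have "G p \<le> G y"
    proof (rule DERIV_nonneg_imp_nondecreasing[of p y G])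
      fix z assume "p \<le> z" "z \<le> y"
      then have "(G has_real_derivative f z) (at z)" using p y by (intro G) auto
      then show "\<exists>D. (G has_real_derivative D) (at z) \<and> 0 \<le> D" using f(2) by blast
    qed (use y in auto)
    ultimately have "measure ?M {p<..y} = G y - G p" by (simp add: measure_def)
    then show ?thesis using cdf_diff_eq[OF y(1)] by simp
  qed
  have "((\<lambda>y. cdf ?M p + (G y - G p)) has_real_derivative f x) (at x)"
    using G[OF x] by (auto intro!: derivative_eq_intros)
  then show ?thesis
    by (rule has_field_derivative_transform_within_open[where S="{p<..<w}"]) (use p x eq in auto)
qed

text \<open>The image of a compact interval under \<open>T\<close> is part of the line, and monotone
  convergence exhausts the left side by such intervals. \<open>T\<close> need not be onto, hence an
  inequality.\<close>

lemma nn_integral_substitution_mono_le: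
  fixes g :: "real \<Rightarrow> ennreal" and T T' :: "real \<Rightarrow> real"
  assumes g: "g \<in> borel_measurable borel"
    and T: "\<And>x. (T has_real_derivative T' x) (at x)" "continuous_on UNIV T'" "\<And>x. 0 \<le> T' x"
  shows "(\<integral>\<^sup>+x. g (T x) * ennreal (T' x) \<partial>lborel) \<le> (\<integral>\<^sup>+x. g x \<partial>lborel)"
proof -
  have [measurable]: "T \<in> borel_measurable borel"
    using T(1) by (intro borel_measurable_continuous_onI DERIV_continuous_on[of _ T T'])
  have [measurable]: "T' \<in> borel_measurable borel"
    using T(2) by (intro borel_measurable_continuous_onI)
  note g[measurable]
  \<comment> \<open>The offset 1 keeps the interval nondegenerate for \<open>i = 0\<close> as
    well.\<close>
  let ?A = "\<lambda>i::nat. {- real i - 1 .. real i + 1}"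
  have sup: "(SUP i. g (T x) * T' x * indicator (?A i) x) = g (T x) * T' x" for x
  proof (rule antisym)
    obtain i where "\<bar>x\<bar> \<le> real i" using real_arch_simple by blast
    then have "g (T x) * T' x = g (T x) * T' x * indicator (?A i) x"
      by (auto simp: indicator_def)
    also have "\<dots> \<le> (SUP i. g (T x) * T' x * indicator (?A i) x)"
      by (rule SUP_upper) simp
    finally show "g (T x) * T' x \<le> (SUP i. g (T x) * T' x * indicator (?A i) x)" .
  qed (auto intro!: SUP_least simp: indicator_def)
  have "(\<integral>\<^sup>+x. g (T x) * T' x \<partial>lborel) = (\<integral>\<^sup>+x. (SUP i. g (T x) * T' x * indicator (?A i) x) \<partial>lborel)"
    by (simp only: sup)
  also have "\<dots> = (SUP i. \<integral>\<^sup>+x. g (T x) * T' x * indicator (?A i) x \<partial>lborel)"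
    by (intro nn_integral_monotone_convergence_SUP)
       (auto simp: incseq_def le_fun_def indicator_def)
  also have "\<dots> \<le> (\<integral>\<^sup>+x. g x \<partial>lborel)"
  proof (rule SUP_least)
    fix i
    have "(\<integral>\<^sup>+x. g (T x) * T' x * indicator (?A i) x \<partial>lborel) =
        (\<integral>\<^sup>+x. g x * indicator {T (- real i - 1)..T (real i + 1)} x \<partial>lborel)"
      using T by (intro nn_integral_substitution_aux[symmetric]) (auto intro: continuous_on_subset)
    also have "\<dots> \<le> (\<integral>\<^sup>+x. g x \<partial>lborel)"
      by (intro nn_integral_mono) (auto simp: indicator_def)
    finally show "(\<integral>\<^sup>+x. g (T x) * T' x * indicator (?A i) x \<partial>lborel) \<le> (\<integral>\<^sup>+x. g x \<partial>lborel)" .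
  qed
  finally show ?thesis .
qed

text \<open>\<open>T\<close> is the quantile function of \<open>\<mu>\<close> after the normal cdf.
  Positivity of \<open>f\<close> makes the cdf of \<open>\<mu>\<close> strictly increasing on [0,1];
  since the normal cdf takes values strictly between 0 and 1, \<open>T\<close> avoids the end
  points, where the density jumps, and is differentiable everywhere.\<close>

lemma gaussian_transport:
  fixes f :: "real \<Rightarrow> real"
  assumes f: "continuous_on UNIV f" "\<And>x. 0 < f x"
  defines "\<mu> \<equiv> density lborel (\<lambda>s. ennreal (f s * indicator {0..1} s))"
  assumes "prob_space \<mu>"
  obtains T where "\<And>a. 0 < T a" "\<And>a. T a < 1"
    "\<And>a. (T has_real_derivative std_normal_density a / f (T a)) (at a)"
    "distr (gaussian_noise 1) borel T = \<mu>"
proof -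
  let ?f = "\<lambda>s. f s * indicator {0..1} s"
  interpret \<mu>: prob_space \<mu> by fact
  interpret \<mu>: real_distribution \<mu> by standard (auto simp: \<mu>_def)
  have [measurable]: "f \<in> borel_measurable borel"
    using f(1) by (rule borel_measurable_continuous_onI)
  define N where "N = gaussian_noise 1"
  interpret N: prob_space N unfolding N_def gaussian_noise_def by (rule prob_space_normal_density) simp
  interpret N: real_distribution N by standard (auto simp: N_def gaussian_noise_def)
  define F where "F = cdf \<mu>"
  define P where "P = cdf N"
  have dP: "(P has_real_derivative std_normal_density a) (at a)" for a
    unfolding P_def N_def gaussian_noise_def
    by (rule has_real_derivative_cdf_density[where u="a - 1" and w="a + 1"])
      (use N.real_distribution_axioms in \<open>auto simp: N_def gaussian_noise_def normal_density_def[abs_def] intro!: continuous_intros\<close>)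
  have dF: "(F has_real_derivative f x) (at x)" if x: "0 < x" "x < 1" for x
  proof -
    have "isCont ?f y" if y: "0 < y" "y < 1" for y
    proof -
      have "isCont f y" using f(1) by (simp add: continuous_on_eq_continuous_at)
      moreover have "\<forall>\<^sub>F s in nhds y. ?f s = f s"
        using eventually_nhds_in_open[of "{0<..<1}" y] y by (auto elim!: eventually_mono)
      ultimately show ?thesis using isCont_cong[of ?f f y] by iprover
    qed
    then have "(F has_real_derivative ?f x) (at x)"
      unfolding F_def \<mu>_def using x f(2) \<mu>.real_distribution_axioms
      by (intro has_real_derivative_cdf_density[where u=0 and w=1]) (auto simp: \<mu>_def less_imp_le)
    then show ?thesis using x by simp
  qed
  \<comment> \<open>Used for \<open>{..0}\<close>, for \<open>{1<..}\<close> and for single points: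
    each meets the unit interval in at most one point.\<close>
  have null: "emeasure \<mu> A = 0" if A: "A \<in> sets borel" "A \<inter> {0..1} \<subseteq> {c}" for A c
  proof -
    have "emeasure \<mu> A = (\<integral>\<^sup>+s. ennreal (?f s) * indicator A s \<partial>lborel)"
      unfolding \<mu>_def using A by (intro emeasure_density) auto
    also have "\<dots> = 0"
    proof (subst nn_integral_0_iff_AE)
      show "AE s in lborel. ennreal (?f s) * indicator A s = 0"
        using AE_lborel_singleton[of c] by eventually_elim (use A in \<open>auto simp: indicator_def\<close>)
    qed (use A in auto)
    finally show ?thesis .
  qed
  have "emeasure \<mu> {..0} = 0" by (rule null[of _ 0]) auto
  then have F0: "F 0 = 0" by (simp add: F_def cdf_def measure_def)
  have F_mono: "x \<le> y \<Longrightarrow> F x \<le> F y" for x y unfolding F_def by (rule \<mu>.cdf_nondecreasing)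
  have F_neg: "F x = 0" if "x \<le> 0" for x
    using F_mono[OF that] F0 \<mu>.cdf_nonneg[of x] unfolding F_def by simp
  have "emeasure \<mu> {1<..} = 0" by (rule null[of _ 1]) auto
  then have "measure \<mu> {..1} = 1"
    using \<mu>.prob_compl[of "{1<..}"] by (simp add: measure_def Compl_eq_Diff_UNIV[symmetric] not_less)
  then have F1: "F 1 = 1" by (simp add: F_def cdf_def)
  have F_ge: "F x = 1" if "1 \<le> x" for x
    using F_mono[OF that] F1 \<mu>.cdf_bounded_prob[of x] unfolding F_def by simp
  have contF: "isCont F x" for x
    using null[of "{x}" x] unfolding F_def by (simp add: \<mu>.isCont_cdf measure_def)
  have F_strict: "F x < F y" if "0 \<le> x" "x < y" "y \<le> 1" for x y
  proof (rule DERIV_pos_imp_increasing_open[of x y F])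
    fix z assume "x < z" "z < y"
    then have "(F has_real_derivative f z) (at z)" using that by (intro dF) auto
    then show "\<exists>D. (F has_real_derivative D) (at z) \<and> 0 < D" using f(2) by blast
  qed (use that contF in \<open>auto intro: continuous_at_imp_continuous_on\<close>)
  have P_strict: "P x < P y" if "x < y" for x y
    using DERIV_pos_imp_increasing[OF that] dP normal_density_pos[of 1] by (metis zero_less_one)
  have P_pos: "0 < P a" for a
    using P_strict[of "a - 1" a] N.cdf_nonneg[of "a - 1"] unfolding P_def by simp
  have P_less: "P a < 1" for a
    using P_strict[of a "a + 1"] N.cdf_bounded_prob[of "a + 1"] unfolding P_def by simp
  \<comment> \<open>Only arguments strictly between 0 and 1 matter, since \<open>P\<close> takes no
    other values; for these the preimage under \<open>F\<close> exists and is unique.\<close>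
  define I where "I p = (SOME s. 0 < s \<and> s < 1 \<and> F s = p)" for p
  have I: "0 < I p \<and> I p < 1 \<and> F (I p) = p" if p: "0 < p" "p < 1" for p
  proof -
    have "\<exists>s. 0 \<le> s \<and> s \<le> 1 \<and> F s = p"
      using IVT[of F 0 p 1] p F0 F1 contF by auto
    then obtain s where s: "0 \<le> s" "s \<le> 1" "F s = p" by blast
    moreover have "s \<noteq> 0" "s \<noteq> 1" using p s F0 F1 by auto
    ultimately have "0 < s \<and> s < 1 \<and> F s = p" by auto
    then show ?thesis unfolding I_def by (rule someI)
  qed
  have IF: "I (F x) = x" if x: "0 < x" "x < 1" for x
  proof -
    have "0 < F x" "F x < 1" using F_strict[of 0 x] F_strict[of x 1] x F0 F1 by auto
    from I[OF this] show ?thesis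
      using F_strict[of x "I (F x)"] F_strict[of "I (F x)" x] x by (cases x "I (F x)" rule: linorder_cases) auto
  qed
  have dI: "(I has_real_derivative inverse (f (I p))) (at p)" if p: "0 < p" "p < 1" for p
  proof (rule DERIV_inverse_function[where f=F and a=0 and b=1])
    show "(F has_real_derivative f (I p)) (at (I p))" using I[OF p] by (auto intro!: dF)
    show "f (I p) \<noteq> 0" using f(2)[of "I p"] by simp
    show "F (I y) = y" if "0 < y" "y < 1" for y using I[OF that] by simp
    \<comment> \<open>The interval from \<open>I p / 2\<close> to \<open>(I p + 1)/2\<close>
      surrounds \<open>I p\<close> and stays inside the open unit interval, where \<open>I\<close>
      inverts \<open>F\<close>.\<close>
    have "isCont I (F (I p))"
      by (rule isCont_inverse_function2[where a="I p / 2" and b="(I p + 1)/2"])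
        (use I[OF p] IF contF in auto)
    then show "isCont I p" using I[OF p] by simp
  qed (use p in auto)
  define T where "T a = I (P a)" for a
  have T: "0 < T a" "T a < 1" "F (T a) = P a" for a
    using I[OF P_pos P_less] by (auto simp: T_def)
  have dT: "(T has_real_derivative std_normal_density a / f (T a)) (at a)" for a
    unfolding T_def using DERIV_chain2[OF dI[OF P_pos P_less] dP, of a]
    by (simp add: field_simps)
  have [measurable]: "T \<in> borel_measurable borel"
    using dT by (intro borel_measurable_continuous_onI DERIV_continuous_on) auto
  interpret D: real_distribution "distr N borel T"
    by (rule N.real_distribution_distr) auto
  have "cdf (distr N borel T) x = F x" for x
  proof -
    have cdfT: "cdf (distr N borel T) x = measure N {a. T a \<le> x}"
      by (auto simp: cdf_def measure_distr intro!: arg_cong[where f="measure N"])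
    consider "x \<le> 0" | "0 < x" "x < 1" | "1 \<le> x" by linarith
    then show ?thesis
    proof cases
      case 1
      then have "{a. T a \<le> x} = {}" using T(1) by (auto simp: not_le intro: le_less_trans)
      then show ?thesis using 1 F_neg cdfT by simp
    next
      case 3
      then have "{a. T a \<le> x} = space N" using T(2) by (auto intro: less_imp_le less_le_trans)
      then show ?thesis using 3 F_ge cdfT N.prob_space by simp
    next
      case 2
      then have Fx: "0 < F x" "F x < 1" using F_strict[of 0 x] F_strict[of x 1] F0 F1 by auto
      have "\<forall>\<^sub>F a in at_top. F x < P a"
        using order_tendstoD(1)[OF N.cdf_lim_at_top_prob Fx(2)] unfolding P_def .
      then obtain b where b: "\<And>a. b \<le> a \<Longrightarrow> F x < P a" by (auto simp: eventually_at_top_linorder)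
      have "\<forall>\<^sub>F a in at_bot. P a < F x"
        using order_tendstoD(2)[OF N.cdf_lim_at_bot Fx(1)] unfolding P_def .
      then obtain c where c: "\<And>a. a \<le> c \<Longrightarrow> P a < F x" by (auto simp: eventually_at_bot_linorder)
      have "P (min b c) \<le> F x" "F x \<le> P (max b c)"
        using b[of "max b c"] c[of "min b c"] by auto
      then obtain q where q: "P q = F x"
        using IVT[of P "min b c" "F x" "max b c"] dP DERIV_isCont by (metis max.cobounded1 min.coboundedI1)
      have "T a \<le> x \<longleftrightarrow> a \<le> q" for a
      proof -
        have "T a \<le> x \<longleftrightarrow> F (T a) \<le> F x"
          using F_mono[of "T a" x] F_strict[of x "T a"] 2 T(2)[of a] by (meson leD le_less_linear less_imp_le)
        also have "\<dots> \<longleftrightarrow> a \<le> q" unfolding T(3) q[symmetric]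
          using P_strict[of a q] P_strict[of q a] by (cases a q rule: linorder_cases) auto
        finally show ?thesis .
      qed
      then have "{a. T a \<le> x} = {..q}" by auto
      then show ?thesis using cdfT q by (simp add: P_def cdf_def)
    qed
  qed
  then have "distr N borel T = \<mu>"
    using cdf_unique[OF D.real_distribution_axioms \<mu>.real_distribution_axioms] unfolding F_def by auto
  then show ?thesis using that T(1,2) dT unfolding N_def by blast
qed

section \<open>Entropy power inequality with Gaussian noise\<close>

text \<open>The Lebesgue density of S + Z when S has law \<open>\<mu>\<close> and Z is independent
  Gaussian noise, that is, of the channel output.\<close>

definition smoothed_density :: "real \<Rightarrow> real measure \<Rightarrow> real \<Rightarrow> real" where
  "smoothed_density \<sigma> \<mu> y = (\<integral>s. normal_density 0 \<sigma> (y - s) \<partial>\<mu>)"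

lemma space_gaussian_noise [simp]: "space (gaussian_noise \<sigma>) = UNIV"
  and sets_gaussian_noise [simp, measurable_cong]: "sets (gaussian_noise \<sigma>) = sets borel"
  by (auto simp: gaussian_noise_def)

lemma prob_space_gaussian_noise: "0 < \<sigma> \<Longrightarrow> prob_space (gaussian_noise \<sigma>)"
  unfolding gaussian_noise_def by (rule prob_space_normal_density)

lemma gaussian_noise_moments:
  assumes "0 < \<sigma>"
  shows "integrable (gaussian_noise \<sigma>) (\<lambda>z. z)" "(\<integral>z. z \<partial>gaussian_noise \<sigma>) = 0"
    "integrable (gaussian_noise \<sigma>) (\<lambda>z. z\<^sup>2)" "(\<integral>z. z\<^sup>2 \<partial>gaussian_noise \<sigma>) = \<sigma>\<^sup>2"
proof -
  show "integrable (gaussian_noise \<sigma>) (\<lambda>z. z)" "(\<integral>z. z \<partial>gaussian_noise \<sigma>) = 0"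
    using normal_moment_nz_1[OF assms, of 0]
    by (auto simp: gaussian_noise_def integrable_real_density integral_real_density has_bochner_integral_iff)
  show "integrable (gaussian_noise \<sigma>) (\<lambda>z. z\<^sup>2)" "(\<integral>z. z\<^sup>2 \<partial>gaussian_noise \<sigma>) = \<sigma>\<^sup>2"
    using normal_moment_even[OF assms, of 0 1]
    by (auto simp: gaussian_noise_def integrable_real_density integral_real_density has_bochner_integral_iff)
qed

lemma ln_normal_density:
  assumes "0 < \<sigma>"
  shows "ln (normal_density 0 \<sigma> x) = - ln (2 * pi * \<sigma>\<^sup>2) / 2 - x\<^sup>2 / (2 * \<sigma>\<^sup>2)"
proof -
  have "0 < 2 * pi * \<sigma>\<^sup>2" using assms by simp
  then show ?thesis using assms by (simp add: normal_density_def ln_divide_pos ln_sqrt del: real_sqrt_mult)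
qed

lemma distr_pair_snd:
  assumes "prob_space M" "sigma_finite_measure N"
  shows "distr (M \<Otimes>\<^sub>M N) N snd = N"
proof (rule measure_eqI)
  interpret M: prob_space M by fact
  interpret N: sigma_finite_measure N by fact
  fix A assume A: "A \<in> sets (distr (M \<Otimes>\<^sub>M N) N snd)"
  then have "snd -` A \<inter> space (M \<Otimes>\<^sub>M N) = space M \<times> A"
    using sets.sets_into_space[of A N] by (auto simp: space_pair_measure)
  then show "emeasure (distr (M \<Otimes>\<^sub>M N) N snd) A = emeasure N A"
    using A by (simp add: emeasure_distr N.emeasure_pair_measure_Times M.emeasure_space_1)
qed simp

lemma square_add_le: "((x::real) + y)\<^sup>2 \<le> 2 * x\<^sup>2 + 2 * y\<^sup>2"
  using sum_squares_ge_zero[of "x - y" 0] by (simp add: power2_eq_square algebra_simps)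

locale unit_law = prob_space \<mu> for \<mu> :: "real measure" +
  fixes \<sigma> :: real
  assumes sets_mu [measurable_cong]: "sets \<mu> = sets borel"
    and AE_unit: "AE s in \<mu>. 0 \<le> s \<and> s \<le> 1"
    and sigma_pos: "0 < \<sigma>"
begin

abbreviation "g \<equiv> smoothed_density \<sigma> \<mu>"

sublocale noise: prob_space "gaussian_noise \<sigma>"
  using sigma_pos by (rule prob_space_gaussian_noise)

sublocale joint: pair_prob_space \<mu> "gaussian_noise \<sigma>" ..

lemma space_mu [simp]: "space \<mu> = UNIV"
  using sets_eq_imp_space_eq[OF sets_mu] by simp

lemma normal_density_le: "normal_density 0 \<sigma> x \<le> 1 / sqrt (2 * pi * \<sigma>\<^sup>2)"
  using sigma_pos by (auto simp: normal_density_def intro!: divide_right_mono)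

lemma integrable_kernel: "integrable \<mu> (\<lambda>s. normal_density 0 \<sigma> (y - s))"
  using normal_density_le by (intro integrable_const_bound[where B="1 / sqrt (2 * pi * \<sigma>\<^sup>2)"]) auto

lemma measurable_smoothed_density [measurable]: "g \<in> borel_measurable borel"
  unfolding smoothed_density_def by measurable

text \<open>For \<open>s\<close> in the unit interval \<open>\<bar>y - s\<bar>\<close> is at most
  \<open>\<bar>y\<bar> + 1\<close>, which bounds the kernel from below; its peak bounds it from
  above. Thus \<open>ln (g y)\<close> grows at most quadratically.\<close>

lemma smoothed_density_bounds:
  "exp (- (\<bar>y\<bar> + 1)\<^sup>2 / (2 * \<sigma>\<^sup>2)) / sqrt (2 * pi * \<sigma>\<^sup>2) \<le> g y"
  "g y \<le> 1 / sqrt (2 * pi * \<sigma>\<^sup>2)"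
proof -
  have "AE s in \<mu>. exp (- (\<bar>y\<bar> + 1)\<^sup>2 / (2 * \<sigma>\<^sup>2)) / sqrt (2 * pi * \<sigma>\<^sup>2) \<le> normal_density 0 \<sigma> (y - s)"
    using AE_unit
  proof eventually_elim
    fix s :: real assume s: "0 \<le> s \<and> s \<le> 1"
    then have "(y - s)\<^sup>2 \<le> (\<bar>y\<bar> + 1)\<^sup>2" by (intro power2_le_iff_abs_le[THEN iffD2]) auto
    then show "exp (- (\<bar>y\<bar> + 1)\<^sup>2 / (2 * \<sigma>\<^sup>2)) / sqrt (2 * pi * \<sigma>\<^sup>2) \<le> normal_density 0 \<sigma> (y - s)"
      using sigma_pos by (auto simp: normal_density_def intro!: divide_right_mono)
  qed
  then show "exp (- (\<bar>y\<bar> + 1)\<^sup>2 / (2 * \<sigma>\<^sup>2)) / sqrt (2 * pi * \<sigma>\<^sup>2) \<le> g y"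
    unfolding smoothed_density_def
    by (intro integral_ge_const integrable_kernel)
  show "g y \<le> 1 / sqrt (2 * pi * \<sigma>\<^sup>2)"
    unfolding smoothed_density_def using normal_density_le
    by (intro integral_le_const integrable_kernel) auto
qed

lemma smoothed_density_pos: "0 < g y"
  using smoothed_density_bounds(1)[of y] sigma_pos
  by (smt (verit) divide_pos_pos exp_gt_zero pi_gt_zero real_sqrt_gt_zero zero_less_mult_iff zero_less_power)

lemma abs_ln_smoothed_density_le:
  "\<bar>ln (g y)\<bar> \<le> \<bar>ln (2 * pi * \<sigma>\<^sup>2)\<bar> / 2 + (y\<^sup>2 + 1) / \<sigma>\<^sup>2"
proof -
  have "0 < sqrt (2 * pi * \<sigma>\<^sup>2)" using sigma_pos by simp
  then have "- (\<bar>y\<bar> + 1)\<^sup>2 / (2 * \<sigma>\<^sup>2) - ln (2 * pi * \<sigma>\<^sup>2) / 2 \<le> ln (g y)"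
    "ln (g y) \<le> - ln (2 * pi * \<sigma>\<^sup>2) / 2"
    using ln_mono[OF smoothed_density_bounds(1)[of y]] ln_mono[OF smoothed_density_bounds(2)[of y]]
      smoothed_density_pos[of y] sigma_pos
    by (auto simp: ln_divide_pos ln_sqrt simp del: real_sqrt_mult)
  moreover have "(\<bar>y\<bar> + 1)\<^sup>2 / (2 * \<sigma>\<^sup>2) \<le> (y\<^sup>2 + 1) / \<sigma>\<^sup>2"
    using square_add_le[of "\<bar>y\<bar>" 1] sigma_pos by (simp add: field_simps)
  moreover have "0 \<le> (y\<^sup>2 + 1) / \<sigma>\<^sup>2" by simp
  ultimately show ?thesis by linarith
qed

lemma nn_integral_smoothed_density: "(\<integral>\<^sup>+y. ennreal (g y) \<partial>lborel) = 1"
proof -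
  interpret pair_sigma_finite lborel \<mu> ..
  have "(\<integral>\<^sup>+y. ennreal (g y) \<partial>lborel) = (\<integral>\<^sup>+y. \<integral>\<^sup>+s. ennreal (normal_density 0 \<sigma> (y - s)) \<partial>\<mu> \<partial>lborel)"
    unfolding smoothed_density_def
    by (intro nn_integral_cong nn_integral_eq_integral[symmetric] integrable_kernel) auto
  also have "\<dots> = (\<integral>\<^sup>+s. \<integral>\<^sup>+y. ennreal (normal_density 0 \<sigma> (y - s)) \<partial>lborel \<partial>\<mu>)"
    by (rule Fubini'[symmetric]) measurable
  also have "\<dots> = (\<integral>\<^sup>+s. 1 \<partial>\<mu>)"
  proof (rule nn_integral_cong)
    fix s
    have "(\<integral>\<^sup>+y. ennreal (normal_density 0 \<sigma> (y - s)) \<partial>lborel) = (\<integral>\<^sup>+y. ennreal (normal_density s \<sigma> y) \<partial>lborel)"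
      by (simp add: normal_density_def)
    also have "\<dots> = 1"
      using sigma_pos by (subst nn_integral_eq_integral) auto
    finally show "(\<integral>\<^sup>+y. ennreal (normal_density 0 \<sigma> (y - s)) \<partial>lborel) = 1" .
  qed
  also have "\<dots> = 1" using emeasure_space_1 by simp
  finally show ?thesis .
qed

end

section \<open>Gaussian integrability and the change of variables along a rotation\<close>

lemma integrable_quadratic_bound:
  fixes F :: "real \<times> real \<Rightarrow> real"
  assumes \<sigma>: "0 < \<sigma>" "0 < \<tau>"
    and F: "F \<in> borel_measurable (gaussian_noise \<tau> \<Otimes>\<^sub>M gaussian_noise \<sigma>)"
    and bound: "\<And>a z. \<bar>F (a, z)\<bar> \<le> A + B * a\<^sup>2 + C * z\<^sup>2"
  shows "integrable (gaussian_noise \<tau> \<Otimes>\<^sub>M gaussian_noise \<sigma>) F"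
proof -
  interpret N: prob_space "gaussian_noise \<tau>" using \<sigma>(2) by (rule prob_space_gaussian_noise)
  interpret G: prob_space "gaussian_noise \<sigma>" using \<sigma>(1) by (rule prob_space_gaussian_noise)
  interpret pair_prob_space "gaussian_noise \<tau>" "gaussian_noise \<sigma>" ..
  have "integrable (gaussian_noise \<tau> \<Otimes>\<^sub>M gaussian_noise \<sigma>) (\<lambda>p. (fst p)\<^sup>2)"
    by (subst integrable_distr_eq[where M="gaussian_noise \<tau> \<Otimes>\<^sub>M gaussian_noise \<sigma>" and N="gaussian_noise \<tau>" and g=fst, symmetric])
      (auto simp: G.distr_pair_fst gaussian_noise_moments \<sigma>)
  moreover have "integrable (gaussian_noise \<tau> \<Otimes>\<^sub>M gaussian_noise \<sigma>) (\<lambda>p. (snd p)\<^sup>2)"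
    by (subst integrable_distr_eq[where M="gaussian_noise \<tau> \<Otimes>\<^sub>M gaussian_noise \<sigma>" and N="gaussian_noise \<sigma>" and g=snd, symmetric])
      (auto simp: distr_pair_snd N.prob_space_axioms G.sigma_finite_measure_axioms gaussian_noise_moments \<sigma>)
  ultimately have "integrable (gaussian_noise \<tau> \<Otimes>\<^sub>M gaussian_noise \<sigma>) (\<lambda>p. A + B * (fst p)\<^sup>2 + C * (snd p)\<^sup>2)"
    by simp
  then show ?thesis
    by (rule Bochner_Integration.integrable_bound) (use F bound in \<open>auto intro!: AE_I2 order_trans[OF _ abs_ge_self]\<close>)
qed

text \<open>Put U = c A + r Z / \<sigma> and V = c Z / \<sigma> - r A, again independent standard
  normals. Division by the density of U leaves, for fixed V, the integral over U of \<open>g\<close>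
  at the output times the derivative of the output in U, which is at most the total mass of
  \<open>g\<close>. The computation runs over A instead of U: for fixed V, U = (A + r V) / c, so the
  derivative c T' + \<sigma> r becomes T' + \<sigma> r / c.\<close>

lemma (in unit_law) gaussian_jacobian_bound:
  fixes T T' :: "real \<Rightarrow> real"
  assumes T: "\<And>a. (T has_real_derivative T' a) (at a)" "continuous_on UNIV T'" "\<And>a. 0 \<le> T' a"
    and cs: "c\<^sup>2 + r\<^sup>2 = 1" "0 < c" "0 < r"
  shows "(\<integral>\<^sup>+p. ennreal (g (T (fst p) + snd p) * (c * T' (fst p) + \<sigma> * r)
              / std_normal_density (c * fst p + r * snd p / \<sigma>))
            \<partial>(gaussian_noise 1 \<Otimes>\<^sub>M gaussian_noise \<sigma>)) \<le> 1"
proof -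
  have [measurable]: "T \<in> borel_measurable borel"
    using T(1) by (intro borel_measurable_continuous_onI DERIV_continuous_on) auto
  have [measurable]: "T' \<in> borel_measurable borel"
    using T(2) by (intro borel_measurable_continuous_onI)
  let ?k = std_normal_density
  let ?R = "\<lambda>a z. g (T a + z) * (c * T' a + \<sigma> * r) / ?k (c * a + r * z / \<sigma>)"
  let ?W = "\<lambda>a v. T a + (\<sigma> * r / c) * a + (\<sigma> / c) * v"
  have R0: "0 \<le> ?R a z" for a z
    using smoothed_density_pos[of "T a + z"] T(3)[of a] cs sigma_pos by (simp add: less_imp_le)
  \<comment> \<open>Rotation invariance of the planar Gaussian; the factor 1 / \<sigma> comes from
    rescaling \<open>z\<close> to \<open>z / \<sigma>\<close>.\<close>
  have rot: "?k a * normal_density 0 \<sigma> z = ?k (c * a + r * z / \<sigma>) * ?k (c * z / \<sigma> - r * a) / \<sigma>" for a z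
  proof -
    have "a\<^sup>2 + (z / \<sigma>)\<^sup>2 = (c\<^sup>2 + r\<^sup>2) * (a\<^sup>2 + (z / \<sigma>)\<^sup>2)" using cs by simp
    also have "\<dots> = (c * a + r * (z / \<sigma>))\<^sup>2 + (c * (z / \<sigma>) - r * a)\<^sup>2"
      by algebra
    finally have "- a\<^sup>2 / 2 + - z\<^sup>2 / (2 * \<sigma>\<^sup>2) = - (c * a + r * z / \<sigma>)\<^sup>2 / 2 + - (c * z / \<sigma> - r * a)\<^sup>2 / 2"
      by (simp add: power_divide)
    then have "exp (- a\<^sup>2 / 2) * exp (- z\<^sup>2 / (2 * \<sigma>\<^sup>2)) = exp (- (c * a + r * z / \<sigma>)\<^sup>2 / 2) * exp (- (c * z / \<sigma> - r * a)\<^sup>2 / 2)"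
      by (simp add: exp_add[symmetric])
    then show ?thesis
      using sigma_pos by (simp add: normal_density_def real_sqrt_mult)
  qed
  have "(\<integral>\<^sup>+p. ennreal (?R (fst p) (snd p)) \<partial>(gaussian_noise 1 \<Otimes>\<^sub>M gaussian_noise \<sigma>))
      = (\<integral>\<^sup>+a. \<integral>\<^sup>+z. ennreal (?R a z) \<partial>gaussian_noise \<sigma> \<partial>gaussian_noise 1)"
    by (subst noise.nn_integral_fst[symmetric]) auto
  also have "\<dots> = (\<integral>\<^sup>+a. ennreal (?k a) * (\<integral>\<^sup>+z. ennreal (normal_density 0 \<sigma> z) * ennreal (?R a z) \<partial>lborel) \<partial>lborel)"
    unfolding gaussian_noise_def by (subst nn_integral_density) (auto simp: nn_integral_density)
  also have "\<dots> = (\<integral>\<^sup>+a. \<integral>\<^sup>+v. ennreal (g (?W a v) * (T' a + \<sigma> * r / c) * ?k v) \<partial>lborel \<partial>lborel)"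
  proof (rule nn_integral_cong)
    fix a
    have "ennreal (?k a) * (\<integral>\<^sup>+z. ennreal (normal_density 0 \<sigma> z) * ennreal (?R a z) \<partial>lborel)
        = (\<integral>\<^sup>+z. ennreal (?k a) * (ennreal (normal_density 0 \<sigma> z) * ennreal (?R a z)) \<partial>lborel)"
      by (rule nn_integral_cmult[symmetric]) measurable
    also have "\<dots> = (\<integral>\<^sup>+z. ennreal (g (T a + z) * (c * T' a + \<sigma> * r) * ?k (c * z / \<sigma> - r * a) / \<sigma>) \<partial>lborel)"
    proof (rule nn_integral_cong)
      fix z
      have "ennreal (?k a) * (ennreal (normal_density 0 \<sigma> z) * ennreal (?R a z))
          = ennreal ((?k a * normal_density 0 \<sigma> z) * ?R a z)"
        using R0[of a z] by (simp only: ennreal_mult[symmetric] mult.assoc normal_density_nonneg mult_nonneg_nonneg)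
      also have "(?k a * normal_density 0 \<sigma> z) * ?R a z = g (T a + z) * (c * T' a + \<sigma> * r) * ?k (c * z / \<sigma> - r * a) / \<sigma>"
        unfolding rot using normal_density_pos[of 1 0 "c * a + r * z / \<sigma>"] sigma_pos by (simp add: field_simps)
      finally show "ennreal (?k a) * (ennreal (normal_density 0 \<sigma> z) * ennreal (?R a z))
          = ennreal (g (T a + z) * (c * T' a + \<sigma> * r) * ?k (c * z / \<sigma> - r * a) / \<sigma>)" .
    qed
    \<comment> \<open>For fixed \<open>a\<close> the noise is expressed through the second rotated
      coordinate: z = \<sigma> (r a + v) / c.\<close>
    also have "\<dots> = ennreal \<bar>\<sigma> / c\<bar> * (\<integral>\<^sup>+v. ennreal (g (T a + ((\<sigma> * r / c) * a + (\<sigma> / c) * v)) * (c * T' a + \<sigma> * r)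
        * ?k (c * ((\<sigma> * r / c) * a + (\<sigma> / c) * v) / \<sigma> - r * a) / \<sigma>) \<partial>lborel)"
      using sigma_pos cs by (intro nn_integral_real_affine) auto
    also have "\<dots> = (\<integral>\<^sup>+v. ennreal \<bar>\<sigma> / c\<bar> * ennreal (g (T a + ((\<sigma> * r / c) * a + (\<sigma> / c) * v)) * (c * T' a + \<sigma> * r)
        * ?k (c * ((\<sigma> * r / c) * a + (\<sigma> / c) * v) / \<sigma> - r * a) / \<sigma>) \<partial>lborel)"
      by (rule nn_integral_cmult[symmetric]) measurable
    also have "\<dots> = (\<integral>\<^sup>+v. ennreal (g (?W a v) * (T' a + \<sigma> * r / c) * ?k v) \<partial>lborel)"
    proof (rule nn_integral_cong)
      fix v
      have v: "c * ((\<sigma> * r / c) * a + (\<sigma> / c) * v) / \<sigma> - r * a = v"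
        using sigma_pos cs by (simp add: field_simps)
      have "ennreal \<bar>\<sigma> / c\<bar> * ennreal (g (?W a v) * (c * T' a + \<sigma> * r) * ?k v / \<sigma>)
          = ennreal (\<bar>\<sigma> / c\<bar> * (g (?W a v) * (c * T' a + \<sigma> * r) * ?k v / \<sigma>))"
        by (rule ennreal_mult'[symmetric]) simp
      also have "\<bar>\<sigma> / c\<bar> * (g (?W a v) * (c * T' a + \<sigma> * r) * ?k v / \<sigma>) = g (?W a v) * (T' a + \<sigma> * r / c) * ?k v"
        using sigma_pos cs by (simp add: field_simps)
      finally show "ennreal \<bar>\<sigma> / c\<bar> * ennreal (g (T a + ((\<sigma> * r / c) * a + (\<sigma> / c) * v)) * (c * T' a + \<sigma> * r)
        * ?k (c * ((\<sigma> * r / c) * a + (\<sigma> / c) * v) / \<sigma> - r * a) / \<sigma>) = ennreal (g (?W a v) * (T' a + \<sigma> * r / c) * ?k v)"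
        unfolding v by (simp add: add.assoc)
    qed
    finally show "ennreal (?k a) * (\<integral>\<^sup>+z. ennreal (normal_density 0 \<sigma> z) * ennreal (?R a z) \<partial>lborel)
      = (\<integral>\<^sup>+v. ennreal (g (?W a v) * (T' a + \<sigma> * r / c) * ?k v) \<partial>lborel)" .
  qed
  \<comment> \<open>With \<open>v\<close> outside, the inner variable \<open>a\<close> moves the
    output \<open>?W a v\<close> monotonically, and substitution applies.\<close>
  also have "\<dots> = (\<integral>\<^sup>+v. \<integral>\<^sup>+a. ennreal (g (?W a v) * (T' a + \<sigma> * r / c) * ?k v) \<partial>lborel \<partial>lborel)"
    by (rule lborel_pair.Fubini'[symmetric]) measurable
  also have "\<dots> \<le> (\<integral>\<^sup>+v. ennreal (?k v) \<partial>lborel)"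
  proof (rule nn_integral_mono)
    fix v
    have d0: "0 \<le> T' a + \<sigma> * r / c" for a using T(3)[of a] sigma_pos cs by simp
    have "(\<integral>\<^sup>+a. ennreal (g (?W a v) * (T' a + \<sigma> * r / c) * ?k v) \<partial>lborel)
        = (\<integral>\<^sup>+a. ennreal (?k v) * (ennreal (g (?W a v)) * ennreal (T' a + \<sigma> * r / c)) \<partial>lborel)"
      using smoothed_density_pos d0
      by (intro nn_integral_cong) (simp add: ennreal_mult[symmetric] less_imp_le mult_ac)
    also have "\<dots> = ennreal (?k v) * (\<integral>\<^sup>+a. ennreal (g (?W a v)) * ennreal (T' a + \<sigma> * r / c) \<partial>lborel)"
      by (rule nn_integral_cmult) measurable
    also have "(\<integral>\<^sup>+a. ennreal (g (?W a v)) * ennreal (T' a + \<sigma> * r / c) \<partial>lborel) \<le> (\<integral>\<^sup>+y. ennreal (g y) \<partial>lborel)"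
      using T d0 cs(2) by (intro nn_integral_substitution_mono_le) (auto intro!: derivative_eq_intros continuous_intros)
    finally show "(\<integral>\<^sup>+a. ennreal (g (?W a v) * (T' a + \<sigma> * r / c) * ?k v) \<partial>lborel) \<le> ennreal (?k v)"
      by (simp add: nn_integral_smoothed_density mult_left_mono)
  qed
  also have "\<dots> = 1" by (subst nn_integral_eq_integral) auto
  finally show ?thesis .
qed

text \<open>Concavity of \<open>ln\<close> at the points x / c and y / r with weights c^2 and r^2.
  The unit vector thus supplies both the coefficients on the right and the weights on the
  left.\<close>

lemma weighted_ln_le:
  fixes x y c r :: real
  assumes "0 < x" "0 < y" "0 < c" "0 < r" "c\<^sup>2 + r\<^sup>2 = 1"
  shows "c\<^sup>2 * (ln x - ln c) + r\<^sup>2 * (ln y - ln r) \<le> ln (c * x + r * y)"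
proof -
  have eq: "c\<^sup>2 = 1 - r\<^sup>2" using assms by simp
  have "r\<^sup>2 \<le> 1" using assms zero_le_power2[of c] by linarith
  then have "c\<^sup>2 * ln (x / c) + r\<^sup>2 * ln (y / r) \<le> ln (c\<^sup>2 * (x / c) + r\<^sup>2 * (y / r))"
    using concave_onD[OF ln_concave, of "r\<^sup>2" "x / c" "y / r"] assms(1-4) unfolding eq by simp
  then show ?thesis
    using assms by (simp add: ln_divide_pos power2_eq_square)
qed

text \<open>The entropy power inequality written for the gain over the noise entropy: the right side
  is the entropy of S + Z minus that of Z, and \<gamma> is the entropy of S.\<close>

lemma (in unit_law) smoothed_entropy_bound:
  fixes f :: "real \<Rightarrow> real"
  assumes f: "continuous_on UNIV f" "\<And>x. 0 < f x"
    and mu: "\<mu> = density lborel (\<lambda>s. ennreal (f s * indicator {0..1} s))"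
  defines "\<gamma> \<equiv> - (\<integral>s. ln (f s) \<partial>\<mu>)"
  shows "1 / 2 * ln (1 + exp (2 * \<gamma>) / (2 * pi * exp 1 * \<sigma>\<^sup>2))
    \<le> (\<integral>p. ln (normal_density 0 \<sigma> (snd p) / g (fst p + snd p)) \<partial>(\<mu> \<Otimes>\<^sub>M gaussian_noise \<sigma>))"
proof -
  let ?k = std_normal_density
  have [measurable]: "f \<in> borel_measurable borel"
    using f(1) by (rule borel_measurable_continuous_onI)
  have "prob_space (density lborel (\<lambda>s. ennreal (f s * indicator {0..1} s)))"
    using prob_space_axioms unfolding mu .
  from gaussian_transport[OF f this] obtain T where T: "\<And>a. 0 < T a" "\<And>a. T a < 1"
    "\<And>a. (T has_real_derivative ?k a / f (T a)) (at a)"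
    "distr (gaussian_noise 1) borel T = \<mu>" unfolding mu[symmetric] by blast
  have contT: "continuous_on UNIV T" using T(3) by (rule DERIV_continuous_on[where D="\<lambda>a. ?k a / f (T a)"])
  then have [measurable]: "T \<in> borel_measurable borel"
    by (rule borel_measurable_continuous_onI)
  define T' where "T' a = ?k a / f (T a)" for a
  have T'_pos: "0 < T' a" for a using f(2) normal_density_pos[of 1] by (simp add: T'_def)
  have contT': "continuous_on UNIV T'"
    unfolding T'_def normal_density_def
    by (intro continuous_intros continuous_on_compose2[OF f(1) contT]) (use f(2) in \<open>auto simp: less_imp_neq[symmetric]\<close>)
  have [measurable]: "T' \<in> borel_measurable borel"
    using contT' by (rule borel_measurable_continuous_onI)
  \<comment> \<open>\<open>T\<close> stays in the unit interval, where \<open>ln (f x)\<close> is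
    bounded by compactness. This makes \<open>ln (T' a)\<close> quadratic in \<open>a\<close> up to
    a bounded term.\<close>
  obtain b where b: "\<And>a. \<bar>ln (f (T a))\<bar> \<le> b"
  proof -
    have "bounded ((\<lambda>x. ln (f x)) ` {0..1})"
      by (intro compact_imp_bounded compact_continuous_image continuous_intros continuous_on_subset[OF f(1)])
        (use f(2) in \<open>auto simp: less_imp_neq[symmetric]\<close>)
    then obtain b where "\<And>x. x \<in> {0..1} \<Longrightarrow> \<bar>ln (f x)\<bar> \<le> b"
      unfolding bounded_iff by (metis image_eqI real_norm_def)
    then show ?thesis using that[of b] T(1,2) by (simp add: less_imp_le)
  qed

  \<comment> \<open>\<open>\<tau>\<close> is the standard deviation of the Gaussian law with entropy
    \<gamma>, and \<open>D\<close> that of its sum with the independent noise.\<close>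
  define \<tau> where "\<tau> = exp \<gamma> / sqrt (2 * pi * exp 1)"
  define D where "D = sqrt (\<tau>\<^sup>2 + \<sigma>\<^sup>2)"
  define c where "c = \<tau> / D"
  define r where "r = \<sigma> / D"
  have \<tau>: "0 < \<tau>" by (simp add: \<tau>_def)
  have D: "0 < D" "D\<^sup>2 = \<tau>\<^sup>2 + \<sigma>\<^sup>2" using sigma_pos \<tau> by (auto simp: D_def sum_power2_gt_zero_iff)
  have c: "0 < c" and r: "0 < r" using \<tau> D sigma_pos by (auto simp: c_def r_def)
  have cr: "c\<^sup>2 + r\<^sup>2 = 1"
    using D(1) by (simp add: c_def r_def power_divide add_divide_distrib[symmetric] D(2)[symmetric])

  interpret N: prob_space "gaussian_noise 1" by (rule prob_space_gaussian_noise) simp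
  interpret Q: pair_prob_space "gaussian_noise 1" "gaussian_noise \<sigma>" ..
  let ?Q = "gaussian_noise 1 \<Otimes>\<^sub>M gaussian_noise \<sigma>"
  \<comment> \<open>All integrability claims below are pointwise quadratic bounds fed to this
    criterion.\<close>
  note quad = integrable_quadratic_bound[OF sigma_pos zero_less_one]
  have int_fst: "(\<integral>p. h (fst p) \<partial>?Q) = (\<integral>a. h a \<partial>gaussian_noise 1)"
    if "h \<in> borel_measurable borel" for h :: "real \<Rightarrow> real"
    using integral_distr[of fst ?Q "gaussian_noise 1" h] that by (simp add: noise.distr_pair_fst)
  have int_snd: "(\<integral>p. h (snd p) \<partial>?Q) = (\<integral>a. h a \<partial>gaussian_noise \<sigma>)"
    if "h \<in> borel_measurable borel" for h :: "real \<Rightarrow> real"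
    using integral_distr[of snd ?Q "gaussian_noise \<sigma>" h] that
    by (simp add: distr_pair_snd[OF N.prob_space_axioms noise.sigma_finite_measure_axioms])

  \<comment> \<open>The logarithm of the integrand in \<open>gaussian_jacobian_bound\<close>: the
    output density pulled back along U, relative to the normal density. \<open>J\<close> is the
    minorant of its Jacobian term given by concavity.\<close>
  define L where "L p = ln (g (T (fst p) + snd p)) + ln (c * T' (fst p) + \<sigma> * r)
      - ln (?k (c * fst p + r * snd p / \<sigma>))" for p
  define J where "J p = c\<^sup>2 * (ln (T' (fst p)) - ln c) + r\<^sup>2 * (ln \<sigma> - ln r)" for p :: "real \<times> real"

  have lnk: "ln (?k x) = - ln (2 * pi) / 2 - x\<^sup>2 / 2" for x
    using ln_normal_density[of 1 x] by simp
  have lnT': "ln (T' a) = - ln (2 * pi) / 2 - a\<^sup>2 / 2 - ln (f (T a))" for a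
    using f(2)[of "T a"] normal_density_pos[of 1 0 a] by (simp add: T'_def ln_divide_pos lnk)
  have intlng: "integrable ?Q (\<lambda>p. ln (g (T (fst p) + snd p)))"
  proof (rule quad)
    fix a z
    have "(T a + z)\<^sup>2 \<le> 2 * (T a)\<^sup>2 + 2 * z\<^sup>2" by (rule square_add_le)
    also have "\<dots> \<le> 2 + 2 * z\<^sup>2" using T(1,2)[of a] by (simp add: power_le_one)
    finally have "(T a + z)\<^sup>2 + 1 \<le> 3 + 2 * z\<^sup>2" by simp
    then have "((T a + z)\<^sup>2 + 1) / \<sigma>\<^sup>2 \<le> (3 + 2 * z\<^sup>2) / \<sigma>\<^sup>2" by (intro divide_right_mono) auto
    with abs_ln_smoothed_density_le[of "T a + z"]
    show "\<bar>ln (g (T (fst (a, z)) + snd (a, z)))\<bar> \<le> (\<bar>ln (2 * pi * \<sigma>\<^sup>2)\<bar> / 2 + 3 / \<sigma>\<^sup>2) + 0 * a\<^sup>2 + 2 / \<sigma>\<^sup>2 * z\<^sup>2"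
      by (simp add: add_divide_distrib)
  qed measurable
  have intU: "integrable ?Q (\<lambda>p. ln (?k (c * fst p + r * snd p / \<sigma>)))"
  proof (rule quad)
    fix a z
    let ?u = "(c * a + r * z / \<sigma>)\<^sup>2"
    have "?u / 2 \<le> c\<^sup>2 * a\<^sup>2 + r\<^sup>2 / \<sigma>\<^sup>2 * z\<^sup>2"
    proof -
      have "(c * a)\<^sup>2 = c\<^sup>2 * a\<^sup>2" "(r * z / \<sigma>)\<^sup>2 = r\<^sup>2 / \<sigma>\<^sup>2 * z\<^sup>2"
        by (simp_all add: power_mult_distrib power_divide)
      then show ?thesis using square_add_le[of "c * a" "r * z / \<sigma>"] by linarith
    qed
    moreover have "0 \<le> ?u / 2" by simp
    ultimately show "\<bar>ln (?k (c * fst (a, z) + r * snd (a, z) / \<sigma>))\<bar> \<le> \<bar>ln (2 * pi)\<bar> / 2 + c\<^sup>2 * a\<^sup>2 + r\<^sup>2 / \<sigma>\<^sup>2 * z\<^sup>2"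
      unfolding lnk fst_conv snd_conv by linarith
  qed measurable
  have intT': "integrable ?Q (\<lambda>p. ln (T' (fst p)))"
  proof (rule quad)
    fix a z
    show "\<bar>ln (T' (fst (a, z)))\<bar> \<le> (\<bar>ln (2 * pi)\<bar> / 2 + b) + 1 / 2 * a\<^sup>2 + 0 * z\<^sup>2"
      unfolding lnT' fst_conv using b[of a] zero_le_power2[of a] by linarith
  qed measurable
  have intpsi: "integrable ?Q (\<lambda>p. ln (normal_density 0 \<sigma> (snd p)))"
  proof (rule quad)
    fix a z
    show "\<bar>ln (normal_density 0 \<sigma> (snd (a, z)))\<bar> \<le> \<bar>ln (2 * pi * \<sigma>\<^sup>2)\<bar> / 2 + 0 * a\<^sup>2 + 1 / (2 * \<sigma>\<^sup>2) * z\<^sup>2"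
    proof -
      have "z\<^sup>2 / (2 * \<sigma>\<^sup>2) = 1 / (2 * \<sigma>\<^sup>2) * z\<^sup>2" "0 \<le> z\<^sup>2 / (2 * \<sigma>\<^sup>2)" by simp_all
      then show ?thesis unfolding ln_normal_density[OF sigma_pos] snd_conv by linarith
    qed
  qed measurable
  have intV: "integrable ?Q (\<lambda>p. ln (c * T' (fst p) + \<sigma> * r))"
  proof (rule quad)
    fix a z
    \<comment> \<open>The normal density is at most 1, as 2 pi exceeds 1, so only the bound on
      \<open>ln (f (T a))\<close> enters.\<close>
    have T'_le: "T' a \<le> exp b"
    proof -
      have "ln (T' a) \<le> b"
        unfolding lnT' using b[of a] ln_ge_zero[of "2 * pi"] pi_ge_two zero_le_power2[of a] by linarith
      then show ?thesis using T'_pos[of a] by (metis exp_le_cancel_iff exp_ln)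
    qed
    have "\<sigma> * r \<le> c * T' a + \<sigma> * r" "c * T' a + \<sigma> * r \<le> c * exp b + \<sigma> * r"
      using T'_pos[of a] T'_le c by (auto simp: less_imp_le)
    moreover have "0 < \<sigma> * r" using sigma_pos r by simp
    ultimately have "ln (\<sigma> * r) \<le> ln (c * T' a + \<sigma> * r)" "ln (c * T' a + \<sigma> * r) \<le> ln (c * exp b + \<sigma> * r)"
      by (auto intro!: ln_mono)
    then show "\<bar>ln (c * T' (fst (a, z)) + \<sigma> * r)\<bar> \<le> (\<bar>ln (\<sigma> * r)\<bar> + \<bar>ln (c * exp b + \<sigma> * r)\<bar>) + 0 * a\<^sup>2 + 0 * z\<^sup>2"
      by simp
  qed measurable
  have intL: "integrable ?Q L"
    unfolding L_def by (intro Bochner_Integration.integrable_add Bochner_Integration.integrable_diff intlng intV intU)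

  have expL: "exp (L p) = g (T (fst p) + snd p) * (c * T' (fst p) + \<sigma> * r) / ?k (c * fst p + r * snd p / \<sigma>)" for p
  proof -
    have "0 < c * T' (fst p) + \<sigma> * r" using T'_pos[of "fst p"] c r sigma_pos by (simp add: add_pos_pos)
    then show ?thesis
      unfolding L_def exp_diff exp_add using smoothed_density_pos normal_density_pos[of 1] by simp
  qed
  have [measurable]: "L \<in> borel_measurable ?Q" using intL by simp
  have jac: "(\<integral>\<^sup>+p. ennreal (exp (L p)) \<partial>?Q) \<le> 1"
    unfolding expL using T(3) contT' T'_pos cr c r
    by (intro gaussian_jacobian_bound) (auto simp: T'_def less_imp_le)
  have int_expL: "integrable ?Q (\<lambda>p. exp (L p))"
    using jac by (intro integrableI_bounded) (auto intro: le_less_trans)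
  have "ennreal (\<integral>p. exp (L p) \<partial>?Q) \<le> 1"
    using jac by (subst nn_integral_eq_integral[symmetric]) (auto simp: int_expL)
  then have "(\<integral>p. exp (L p) \<partial>?Q) \<le> 1" by simp
  \<comment> \<open>Gibbs' inequality: \<open>L\<close> has exponential mean at most 1, so 1 + t
    \<le> exp t forces its mean to be nonpositive.\<close>
  moreover have "(\<integral>p. 1 + L p \<partial>?Q) \<le> (\<integral>p. exp (L p) \<partial>?Q)"
    using intL int_expL by (intro integral_mono) auto
  ultimately have L_le: "(\<integral>p. L p \<partial>?Q) \<le> 0"
    using intL Q.prob_space by simp

  have intJ: "integrable ?Q J" unfolding J_def using intT' by simp
  \<comment> \<open>Solving the definition of \<open>L\<close> for the logarithm of \<open>g\<close>
    and replacing the Jacobian term by \<open>J\<close> gives a pointwise bound; the mean of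
    \<open>L\<close> can then be dropped because of its sign.\<close>
  have "(\<integral>p. ln (normal_density 0 \<sigma> (snd p)) + J p - ln (?k (c * fst p + r * snd p / \<sigma>)) - L p \<partial>?Q)
     \<le> (\<integral>p. ln (normal_density 0 \<sigma> (snd p) / g (T (fst p) + snd p)) \<partial>?Q)"
  proof (rule integral_mono)
    have lndiv: "ln (normal_density 0 \<sigma> (snd p) / g (T (fst p) + snd p))
        = ln (normal_density 0 \<sigma> (snd p)) - ln (g (T (fst p) + snd p))" for p
      using smoothed_density_pos normal_density_pos[OF sigma_pos] by (intro ln_divide_pos)
    show "integrable ?Q (\<lambda>p. ln (normal_density 0 \<sigma> (snd p) / g (T (fst p) + snd p)))"
      unfolding lndiv using intpsi intlng by simp
    fix p
    have "J p \<le> ln (c * T' (fst p) + \<sigma> * r)"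
      unfolding J_def using weighted_ln_le[OF T'_pos sigma_pos c r cr, of "fst p"] by (simp add: mult.commute)
    then show "ln (normal_density 0 \<sigma> (snd p)) + J p - ln (?k (c * fst p + r * snd p / \<sigma>)) - L p
        \<le> ln (normal_density 0 \<sigma> (snd p) / g (T (fst p) + snd p))"
      unfolding lndiv L_def by simp
  qed (use intpsi intJ intU intL in simp)
  then have lower: "(\<integral>p. ln (normal_density 0 \<sigma> (snd p)) \<partial>?Q) + (\<integral>p. J p \<partial>?Q)
      - (\<integral>p. ln (?k (c * fst p + r * snd p / \<sigma>)) \<partial>?Q)
     \<le> (\<integral>p. ln (normal_density 0 \<sigma> (snd p) / g (T (fst p) + snd p)) \<partial>?Q)"
    using L_le intpsi intJ intU intL by simp

  have Epsi: "(\<integral>p. ln (normal_density 0 \<sigma> (snd p)) \<partial>?Q) = - ln (2 * pi * \<sigma>\<^sup>2) / 2 - 1 / 2"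
  proof -
    have "(\<integral>p. ln (normal_density 0 \<sigma> (snd p)) \<partial>?Q) = (\<integral>z. ln (normal_density 0 \<sigma> z) \<partial>gaussian_noise \<sigma>)"
      by (rule int_snd) measurable
    then show ?thesis
      using sigma_pos noise.prob_space by (simp add: ln_normal_density gaussian_noise_moments)
  qed
  have Elnf: "(\<integral>a. ln (f (T a)) \<partial>gaussian_noise 1) = - \<gamma>" "integrable (gaussian_noise 1) (\<lambda>a. ln (f (T a)))"
  proof -
    show "(\<integral>a. ln (f (T a)) \<partial>gaussian_noise 1) = - \<gamma>"
      unfolding \<gamma>_def T(4)[symmetric] by (subst integral_distr) auto
    show "integrable (gaussian_noise 1) (\<lambda>a. ln (f (T a)))"
      using b by (intro N.integrable_const_bound[where B=b]) auto
  qed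
  have EJ: "(\<integral>p. J p \<partial>?Q) = c\<^sup>2 * (- ln (2 * pi) / 2 - 1 / 2 + \<gamma> - ln c) + r\<^sup>2 * (ln \<sigma> - ln r)"
  proof -
    have "(\<integral>p. ln (T' (fst p)) \<partial>?Q) = - ln (2 * pi) / 2 - 1 / 2 + \<gamma>"
    proof -
      have "(\<integral>p. ln (T' (fst p)) \<partial>?Q) = (\<integral>a. ln (T' a) \<partial>gaussian_noise 1)"
        by (rule int_fst) measurable
      then show ?thesis
        using N.prob_space Elnf by (simp add: lnT' gaussian_noise_moments)
    qed
    then show ?thesis unfolding J_def using intT' Q.prob_space by (simp add: right_diff_distrib)
  qed
  \<comment> \<open>U has second moment c^2 + r^2 = 1, since the cross term vanishes by independence
    and centring.\<close>
  have EU: "(\<integral>p. ln (?k (c * fst p + r * snd p / \<sigma>)) \<partial>?Q) = - ln (2 * pi) / 2 - 1 / 2"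
  proof -
    have q: "integrable ?Q (\<lambda>p. (fst p)\<^sup>2)" "integrable ?Q (\<lambda>p. (snd p)\<^sup>2)"
      by (rule quad[where A=0 and B=1 and C=1]; simp)+
    have x: "integrable ?Q (\<lambda>p. fst p * snd p)"
    proof (rule quad)
      fix a z :: real
      have "2 * (\<bar>a\<bar> * \<bar>z\<bar>) \<le> a\<^sup>2 + z\<^sup>2" "0 \<le> \<bar>a\<bar> * \<bar>z\<bar>"
        using sum_squares_bound[of "\<bar>a\<bar>" "\<bar>z\<bar>"] by (simp_all add: mult.assoc)
      then show "\<bar>fst (a, z) * snd (a, z)\<bar> \<le> 0 + 1 * a\<^sup>2 + 1 * z\<^sup>2"
        unfolding fst_conv snd_conv abs_mult by linarith
    qed measurable
    have "(\<integral>p. fst p * snd p \<partial>?Q) = 0"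
      using Q.integral_fst'[OF x] sigma_pos by (simp add: gaussian_noise_moments)
    moreover have "(\<integral>p. (fst p)\<^sup>2 \<partial>?Q) = 1" "(\<integral>p. (snd p)\<^sup>2 \<partial>?Q) = \<sigma>\<^sup>2"
      using sigma_pos by (simp_all add: int_fst[of "\<lambda>a. a\<^sup>2"] int_snd[of "\<lambda>a. a\<^sup>2"] gaussian_noise_moments)
    moreover have "ln (?k (c * fst p + r * snd p / \<sigma>)) = - ln (2 * pi) / 2
        - (c\<^sup>2 / 2 * (fst p)\<^sup>2 + c * r / \<sigma> * (fst p * snd p) + r\<^sup>2 / (2 * \<sigma>\<^sup>2) * (snd p)\<^sup>2)" for p
      unfolding lnk using sigma_pos by (simp add: power2_eq_square field_simps)
    ultimately have "(\<integral>p. ln (?k (c * fst p + r * snd p / \<sigma>)) \<partial>?Q) = - ln (2 * pi) / 2 - (c\<^sup>2 / 2 + r\<^sup>2 / 2)"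
      using q x Q.prob_space sigma_pos by simp
    then show ?thesis using cr by (simp add: add_divide_distrib[symmetric])
  qed
  have ln\<tau>: "\<gamma> = ln \<tau> + ln (2 * pi) / 2 + 1 / 2"
    by (simp add: \<tau>_def ln_divide_pos ln_sqrt ln_mult del: real_sqrt_mult)
  \<comment> \<open>The choice c = \<tau> / D, r = \<sigma> / D makes both averaged quantities equal
    to \<open>ln D\<close>, so the weights cease to matter.\<close>
  have "c\<^sup>2 * (- ln (2 * pi) / 2 - 1 / 2 + \<gamma> - ln c) + r\<^sup>2 * (ln \<sigma> - ln r) = (c\<^sup>2 + r\<^sup>2) * ln D"
  proof -
    have "ln c = ln \<tau> - ln D" "ln r = ln \<sigma> - ln D"
      unfolding c_def r_def using \<tau> D sigma_pos by (simp_all add: ln_divide_pos)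
    then have "- ln (2 * pi) / 2 - 1 / 2 + \<gamma> - ln c = ln D" "ln \<sigma> - ln r = ln D"
      using ln\<tau> by linarith+
    then show ?thesis by (simp only: distrib_right)
  qed
  then have EJ': "(\<integral>p. J p \<partial>?Q) = ln D" unfolding EJ cr by simp
  have "1 / 2 * ln (1 + exp (2 * \<gamma>) / (2 * pi * exp 1 * \<sigma>\<^sup>2)) = ln D - ln (\<sigma>\<^sup>2) / 2"
  proof -
    have "exp (2 * \<gamma>) / (2 * pi * exp 1) = \<tau>\<^sup>2"
      by (simp add: \<tau>_def power_divide exp_double)
    then have "1 + exp (2 * \<gamma>) / (2 * pi * exp 1 * \<sigma>\<^sup>2) = (\<tau>\<^sup>2 + \<sigma>\<^sup>2) / \<sigma>\<^sup>2"
      using sigma_pos by (simp add: field_simps)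
    also have "ln ((\<tau>\<^sup>2 + \<sigma>\<^sup>2) / \<sigma>\<^sup>2) = ln (D\<^sup>2) - ln (\<sigma>\<^sup>2)"
      unfolding D(2) using sigma_pos by (intro ln_divide_pos) (auto simp: sum_power2_gt_zero_iff)
    finally show ?thesis using D(1) by (simp add: ln_realpow)
  qed
  also have "\<dots> = (\<integral>p. ln (normal_density 0 \<sigma> (snd p)) \<partial>?Q) + (\<integral>p. J p \<partial>?Q)
      - (\<integral>p. ln (?k (c * fst p + r * snd p / \<sigma>)) \<partial>?Q)"
  proof -
    have "ln (2 * pi * \<sigma>\<^sup>2) = ln (2 * pi) + ln (\<sigma>\<^sup>2)"
      using sigma_pos by (intro ln_mult_pos) auto
    then show ?thesis unfolding Epsi EJ' EU by (simp add: add_divide_distrib diff_divide_distrib)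
  qed
  also note lower
  also have "(\<integral>p. ln (normal_density 0 \<sigma> (snd p) / g (T (fst p) + snd p)) \<partial>?Q)
     = (\<integral>p. ln (normal_density 0 \<sigma> (snd p) / g (fst p + snd p)) \<partial>(\<mu> \<Otimes>\<^sub>M gaussian_noise \<sigma>))"
  proof -
    have "distr (gaussian_noise 1) borel T \<Otimes>\<^sub>M distr (gaussian_noise \<sigma>) (gaussian_noise \<sigma>) (\<lambda>z. z)
       = distr ?Q (borel \<Otimes>\<^sub>M gaussian_noise \<sigma>) (\<lambda>(a, z). (T a, z))"
      by (intro pair_measure_distr) (auto simp: distr_id2 noise.sigma_finite_measure_axioms)
    then have "\<mu> \<Otimes>\<^sub>M gaussian_noise \<sigma> = distr ?Q (borel \<Otimes>\<^sub>M gaussian_noise \<sigma>) (\<lambda>(a, z). (T a, z))"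
      by (simp add: T(4) distr_id2)
    then show ?thesis by (simp add: integral_distr case_prod_beta)
  qed
  finally show ?thesis .
qed

section \<open>Mutual information of the channel\<close>

text \<open>The law \<open>P\<close> itself is taken as reference measure for the input: relative to
  it the input has density 1 and the pair (X, Y) has density \<psi>(y - S x) with respect to
  \<open>P\<close> times Lebesgue measure. This covers inputs supported on a curve, which have no
  Lebesgue density.\<close>

lemma (in unit_law) channel_information_eq:
  fixes h :: "nat \<Rightarrow> real" and P :: "(nat \<Rightarrow> real) measure"
  assumes P: "prob_space P" "sets P = sets (input_space n)"
    and law: "distr P borel (\<lambda>x. \<Sum>k=1..n. h k * x k) = \<mu>"
  shows "channel_information n h \<sigma> P =
    (\<integral>p. ln (normal_density 0 \<sigma> (snd p) / g (fst p + snd p)) \<partial>(\<mu> \<Otimes>\<^sub>M gaussian_noise \<sigma>))"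
proof -
  let ?G = "gaussian_noise \<sigma>" and ?\<psi> = "normal_density 0 \<sigma>"
  interpret P: prob_space P by fact
  note P(2)[measurable_cong]
  define S where "S x = (\<Sum>k=1..n. h k * x k)" for x :: "nat \<Rightarrow> real"
  have S_meas [measurable]: "S \<in> borel_measurable P"
    unfolding S_def[abs_def] by measurable
  have law': "distr P borel S = \<mu>" using law by (simp add: S_def[abs_def])
  interpret PG: pair_prob_space P ?G ..
  interpret PL: pair_sigma_finite P lborel ..
  interpret I: information_space "P \<Otimes>\<^sub>M ?G" "exp 1" by standard simp
  have Y: "channel_output n h = (\<lambda>(x, z). S x + z)" by (simp add: channel_output_def S_def)
  have g_eq: "g y = (\<integral>x. ?\<psi> (y - S x) \<partial>P)" for y
    unfolding smoothed_density_def law'[symmetric] by (subst integral_distr) auto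
  have g_ennreal: "ennreal (g y) = (\<integral>\<^sup>+x. ennreal (?\<psi> (y - S x)) \<partial>P)" for y
  proof -
    have "integrable P (\<lambda>x. ?\<psi> (y - S x))"
      using integrable_kernel[of y] unfolding law'[symmetric] by (subst (asm) integrable_distr_eq) auto
    then show ?thesis unfolding g_eq by (intro nn_integral_eq_integral[symmetric]) auto
  qed
  have Pxy: "distributed (P \<Otimes>\<^sub>M ?G) (P \<Otimes>\<^sub>M lborel) (\<lambda>p. (fst p, channel_output n h p)) (\<lambda>(x, y). ?\<psi> (y - S x))"
    unfolding distributed_def
  proof (intro conjI)
    show "distr (P \<Otimes>\<^sub>M ?G) (P \<Otimes>\<^sub>M lborel) (\<lambda>p. (fst p, channel_output n h p))
        = density (P \<Otimes>\<^sub>M lborel) (\<lambda>p. ennreal (case p of (x, y) \<Rightarrow> ?\<psi> (y - S x)))" (is "?L = ?R")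
    proof (rule measure_eqI)
      fix A assume A_L: "A \<in> sets ?L"
      then have A [measurable]: "A \<in> sets (P \<Otimes>\<^sub>M lborel)" by simp
      have "emeasure ?L A = (\<integral>\<^sup>+p. indicator A p \<partial>?L)"
        by (rule nn_integral_indicator[OF A_L, symmetric])
      also have "\<dots> = (\<integral>\<^sup>+p. indicator A (fst p, channel_output n h p) \<partial>(P \<Otimes>\<^sub>M ?G))"
        unfolding Y by (subst nn_integral_distr) auto
      also have "\<dots> = (\<integral>\<^sup>+x. \<integral>\<^sup>+z. indicator A (x, S x + z) \<partial>?G \<partial>P)"
        unfolding Y by (subst noise.nn_integral_fst[symmetric]) auto
      also have "\<dots> = (\<integral>\<^sup>+x. \<integral>\<^sup>+y. ennreal (?\<psi> (y - S x)) * indicator A (x, y) \<partial>lborel \<partial>P)"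
      proof (rule nn_integral_cong)
        fix x assume [measurable]: "x \<in> space P"
        have "(\<integral>\<^sup>+z. indicator A (x, S x + z) \<partial>?G) = (\<integral>\<^sup>+z. ennreal (?\<psi> z) * indicator A (x, S x + z) \<partial>lborel)"
          unfolding gaussian_noise_def by (subst nn_integral_density) auto
        also have "\<dots> = ennreal \<bar>1\<bar> * (\<integral>\<^sup>+y. ennreal (?\<psi> (- S x + 1 * y)) * indicator A (x, S x + (- S x + 1 * y)) \<partial>lborel)"
          by (intro nn_integral_real_affine) auto
        finally show "(\<integral>\<^sup>+z. indicator A (x, S x + z) \<partial>?G) = (\<integral>\<^sup>+y. ennreal (?\<psi> (y - S x)) * indicator A (x, y) \<partial>lborel)"
          by simp
      qed
      also have "\<dots> = (\<integral>\<^sup>+p. ennreal (case p of (x, y) \<Rightarrow> ?\<psi> (y - S x)) * indicator A p \<partial>(P \<Otimes>\<^sub>M lborel))"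
        by (subst lborel.nn_integral_fst[symmetric]) auto
      also have "\<dots> = emeasure ?R A" by (rule emeasure_density[OF _ A, symmetric]) measurable
      finally show "emeasure ?L A = emeasure ?R A" .
    qed simp
  qed (auto simp: Y)
  have Px: "distributed (P \<Otimes>\<^sub>M ?G) P fst (\<lambda>_. ennreal 1)"
    unfolding distributed_def by (simp add: noise.distr_pair_fst density_1)
  have Py: "distributed (P \<Otimes>\<^sub>M ?G) lborel (channel_output n h) (\<lambda>y. ennreal (g y))"
    unfolding distributed_def
  proof (intro conjI)
    show "distr (P \<Otimes>\<^sub>M ?G) lborel (channel_output n h) = density lborel (\<lambda>y. ennreal (g y))" (is "?L = ?R")
    proof (rule measure_eqI)
      fix A assume A_L: "A \<in> sets ?L"
      then have A [measurable]: "A \<in> sets borel" by simp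
      have "?L = distr (distr (P \<Otimes>\<^sub>M ?G) (P \<Otimes>\<^sub>M lborel) (\<lambda>p. (fst p, channel_output n h p))) lborel snd"
        by (subst distr_distr) (auto simp: Y comp_def)
      also have "\<dots> = distr (density (P \<Otimes>\<^sub>M lborel) (\<lambda>p. ennreal (case p of (x, y) \<Rightarrow> ?\<psi> (y - S x)))) lborel snd"
        using Pxy by (simp add: distributed_def)
      finally have L: "?L = \<dots>" .
      have "emeasure ?L A = (\<integral>\<^sup>+y. indicator A y \<partial>?L)"
        by (rule nn_integral_indicator[OF A_L, symmetric])
      also have "\<dots> = (\<integral>\<^sup>+p. ennreal (case p of (x, y) \<Rightarrow> ?\<psi> (y - S x)) * indicator A (snd p) \<partial>(P \<Otimes>\<^sub>M lborel))"
        unfolding L by (subst nn_integral_distr, simp, simp, subst nn_integral_density) auto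
      also have "\<dots> = (\<integral>\<^sup>+y. \<integral>\<^sup>+x. ennreal (?\<psi> (y - S x)) * indicator A y \<partial>P \<partial>lborel)"
        by (subst PL.nn_integral_snd[symmetric]) auto
      also have "\<dots> = (\<integral>\<^sup>+y. ennreal (g y) * indicator A y \<partial>lborel)"
        by (intro nn_integral_cong) (simp add: nn_integral_multc g_ennreal)
      also have "\<dots> = emeasure ?R A" by (intro emeasure_density[symmetric]) auto
      finally show "emeasure ?L A = emeasure ?R A" .
    qed simp
  qed (auto simp: Y)
  have "channel_information n h \<sigma> P = prob_space.mutual_information (P \<Otimes>\<^sub>M ?G) (exp 1) P lborel fst (channel_output n h)"
    unfolding channel_information_def prob_space.mutual_information_def[OF PG.prob_space_axioms]
    using P(2) by (intro arg_cong2[where f="KL_divergence (exp 1)"] arg_cong2[where f=pair_measure] distr_cong sets_pair_measure_cong) auto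
  also have "\<dots> = (\<integral>p. (case p of (x, y) \<Rightarrow> ?\<psi> (y - S x)) * log (exp 1) ((case p of (x, y) \<Rightarrow> ?\<psi> (y - S x)) / (1 * g (snd p))) \<partial>(P \<Otimes>\<^sub>M lborel))"
    by (rule I.mutual_information_distr[OF P.sigma_finite_measure_axioms lborel.sigma_finite_measure_axioms Px _ Py _ Pxy])
      (auto intro: less_imp_le smoothed_density_pos)
  also have "\<dots> = (\<integral>p. ln ((case p of (x, y) \<Rightarrow> ?\<psi> (y - S x)) / g (snd p)) \<partial>density (P \<Otimes>\<^sub>M lborel) (\<lambda>p. ennreal (case p of (x, y) \<Rightarrow> ?\<psi> (y - S x))))"
    by (subst integral_real_density) (auto simp: log_def split: prod.split)
  also have "\<dots> = (\<integral>p. ln ((case p of (x, y) \<Rightarrow> ?\<psi> (y - S x)) / g (snd p)) \<partial>distr (P \<Otimes>\<^sub>M ?G) (P \<Otimes>\<^sub>M lborel) (\<lambda>p. (fst p, channel_output n h p)))"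
    using Pxy by (simp add: distributed_def)
  also have "\<dots> = (\<integral>p. ln (?\<psi> (snd p) / g (S (fst p) + snd p)) \<partial>(P \<Otimes>\<^sub>M ?G))"
    unfolding Y by (subst integral_distr) (auto simp: case_prod_beta)
  also have "\<dots> = (\<integral>p. ln (?\<psi> (snd p) / g (fst p + snd p)) \<partial>(\<mu> \<Otimes>\<^sub>M ?G))"
  proof -
    have "distr P borel S \<Otimes>\<^sub>M distr ?G ?G (\<lambda>z. z) = distr (P \<Otimes>\<^sub>M ?G) (borel \<Otimes>\<^sub>M ?G) (\<lambda>(x, z). (S x, z))"
      by (intro pair_measure_distr) (auto simp: distr_id2 noise.sigma_finite_measure_axioms)
    then have "\<mu> \<Otimes>\<^sub>M ?G = distr (P \<Otimes>\<^sub>M ?G) (borel \<Otimes>\<^sub>M ?G) (\<lambda>(x, z). (S x, z))"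
      by (simp add: law' distr_id2)
    then show ?thesis by (simp add: integral_distr case_prod_beta)
  qed
  finally show ?thesis .
qed

section \<open>Allocating the output to the inputs\<close>

text \<open>Going down from the last coordinate, the excess of the mean of coordinate \<open>j\<close> over \<open>\<alpha> j\<close> is
  spread over the coordinates \<open>k > j\<close>, proportionally to their slack \<open>\<alpha> k - m k\<close>. Coordinate
  \<open>j\<close> remains a convex combination of coordinates because \<open>m j > \<alpha> j \<ge> \<alpha> k \<ge> m k\<close>.\<close>

lemma transfer_excess:
  fixes h \<alpha> :: "nat \<Rightarrow> real" and x :: "nat \<Rightarrow> real \<Rightarrow> real"
  assumes h: "\<And>k. k \<in> {1..n} \<Longrightarrow> 0 < h k"
    and \<alpha>: "\<And>j k. 1 \<le> j \<Longrightarrow> j \<le> k \<Longrightarrow> k \<le> n \<Longrightarrow> \<alpha> k \<le> \<alpha> j"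
    and j: "1 \<le> j" "j \<le> n"
    and x: "\<And>k. k \<in> {1..n} \<Longrightarrow> integrable M (x k)"
      "\<And>k s. k \<in> {1..n} \<Longrightarrow> s \<in> {0..1} \<Longrightarrow> x k s \<in> {0..1}"
      "\<And>k. k \<in> {1..n} \<Longrightarrow> x k \<in> borel_measurable borel"
    and later: "\<And>k. k \<in> {j<..n} \<Longrightarrow> integral\<^sup>L M (x k) \<le> \<alpha> k"
    and tail: "(\<Sum>k=j..n. h k * integral\<^sup>L M (x k)) \<le> (\<Sum>k=j..n. h k * \<alpha> k)"
  shows "\<exists>x'. (\<forall>k\<in>{1..n}. integrable M (x' k) \<and> x' k \<in> borel_measurable borel \<and> (\<forall>s\<in>{0..1}. x' k s \<in> {0..1}))
    \<and> (\<forall>s. (\<Sum>k=1..n. h k * x' k s) = (\<Sum>k=1..n. h k * x k s))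
    \<and> (\<forall>k\<in>{j..n}. integral\<^sup>L M (x' k) \<le> \<alpha> k) \<and> (\<forall>k<j. x' k = x k)"
proof (cases "integral\<^sup>L M (x j) \<le> \<alpha> j")
  case True
  then have "integral\<^sup>L M (x k) \<le> \<alpha> k" if "k \<in> {j..n}" for k
    using later[of k] that by (cases "k = j") auto
  then show ?thesis using x by (intro exI[of _ x]) blast
next
  case False
  define m where "m k = integral\<^sup>L M (x k)" for k
  define S where "S = (\<Sum>k\<in>{j<..n}. h k * (\<alpha> k - m k))"
  \<comment> \<open>The fraction of the later slack \<open>S\<close> needed to absorb the excess of
    coordinate \<open>j\<close>; the tail hypothesis says that \<open>S\<close> is at least this
    excess, so \<open>t\<close> is at most 1.\<close>
  define t where "t = h j * (m j - \<alpha> j) / S"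
  \<comment> \<open>Mixing \<open>x j\<close> into coordinate \<open>k\<close> with this weight
    raises the mean there by exactly \<open>t * (\<alpha> k - m k)\<close>.\<close>
  define \<theta> where "\<theta> k = t * (\<alpha> k - m k) / (m j - m k)" for k
  \<comment> \<open>The weight of \<open>x k\<close> given back to coordinate \<open>j\<close>; the
    ratio \<open>h k / h j\<close> keeps the weighted sum unchanged pointwise.\<close>
  define w where "w k = h k * \<theta> k / h j" for k
  define W where "W = sum w {j<..n}"
  have mj: "\<alpha> j < m j" using False by (simp add: m_def)
  have split: "{j..n} = insert j {j<..n}" using j by auto
  have later': "m k \<le> \<alpha> k" "\<alpha> k \<le> \<alpha> j" "0 < h k" "0 < m j - m k" if "k \<in> {j<..n}" for k
  proof -
    show "m k \<le> \<alpha> k" "\<alpha> k \<le> \<alpha> j" "0 < h k" using that later \<alpha>[of j k] h[of k] j by (auto simp: m_def)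
    then show "0 < m j - m k" using mj by simp
  qed
  have hj: "0 < h j" using h j by simp
  have S_ge: "h j * (m j - \<alpha> j) \<le> S"
    using tail by (simp add: split S_def m_def right_diff_distrib sum_subtractf)
  moreover have exc: "0 < h j * (m j - \<alpha> j)" using hj mj by simp
  ultimately have S: "0 < S" by simp
  have t: "0 < t" "t \<le> 1" using S S_ge exc by (auto simp: t_def)
  have tS: "t * S = h j * (m j - \<alpha> j)" using S by (simp add: t_def)
  have \<theta>: "0 \<le> \<theta> k" "\<theta> k \<le> 1" if k: "k \<in> {j<..n}" for k
  proof -
    note l = later'[OF k]
    show "0 \<le> \<theta> k" using t l by (simp add: \<theta>_def)
    have "t * (\<alpha> k - m k) \<le> 1 * (m j - m k)" using t l mj by (intro mult_mono) auto
    then show "\<theta> k \<le> 1" using l by (simp add: \<theta>_def)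
  qed
  have w0: "0 \<le> w k" if "k \<in> {j<..n}" for k using \<theta>[OF that] later'[OF that] hj by (simp add: w_def)
  have \<theta>m: "\<theta> k * (m j - m k) = t * (\<alpha> k - m k)" if "k \<in> {j<..n}" for k
    using later'[OF that] by (simp add: \<theta>_def)
  have wm: "h j * (\<Sum>k\<in>{j<..n}. w k * (m j - m k)) = h j * (m j - \<alpha> j)"
  proof -
    have "h j * (\<Sum>k\<in>{j<..n}. w k * (m j - m k)) = (\<Sum>k\<in>{j<..n}. h k * (\<theta> k * (m j - m k)))"
      using hj by (simp add: sum_distrib_left w_def mult.assoc)
    also have "\<dots> = (\<Sum>k\<in>{j<..n}. t * (h k * (\<alpha> k - m k)))"
      by (intro sum.cong) (auto simp: \<theta>m)
    also have "\<dots> = t * S" by (simp add: S_def sum_distrib_left)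
    finally show ?thesis using tS by simp
  qed
  \<comment> \<open>Each \<open>m j - m k\<close> is at least \<open>m j - \<alpha> j\<close>, while
    by \<open>wm\<close> the differences weighted by \<open>w\<close> sum to exactly
    \<open>m j - \<alpha> j\<close>.\<close>
  have W1: "W \<le> 1"
  proof -
    have "W * (m j - \<alpha> j) = (\<Sum>k\<in>{j<..n}. w k * (m j - \<alpha> j))" by (simp add: W_def sum_distrib_right)
    also have "\<dots> \<le> (\<Sum>k\<in>{j<..n}. w k * (m j - m k))"
      using w0 later' by (intro sum_mono mult_left_mono) fastforce+
    also have "\<dots> = 1 * (m j - \<alpha> j)" using wm hj by simp
    finally show ?thesis using mj by simp
  qed
  define x' where "x' k s = (if k < j then x k s
      else if k = j then (1 - W) * x j s + (\<Sum>i\<in>{j<..n}. w i * x i s)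
      else (1 - \<theta> k) * x k s + \<theta> k * x j s)" for k s
  have x'_lt: "x' k = x k" if "k < j" for k using that by (simp add: x'_def fun_eq_iff)
  have x'_j: "x' j = (\<lambda>s. (1 - W) * x j s + (\<Sum>i\<in>{j<..n}. w i * x i s))" by (simp add: x'_def fun_eq_iff)
  have x'_gt: "x' k = (\<lambda>s. (1 - \<theta> k) * x k s + \<theta> k * x j s)" if "k > j" for k using that by (simp add: x'_def fun_eq_iff)
  have xj: "integrable M (x j)" using x(1) j by simp
  have xi: "integrable M (x i)" if "i \<in> {j<..n}" for i using x(1) that j by auto
  show ?thesis
  proof (intro exI[of _ x'] conjI ballI allI impI)
    fix k assume k: "k \<in> {1..n}"
    consider "k < j" | "k = j" | "k \<in> {j<..n}" using k by fastforce
    note cases = this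
    show "integrable M (x' k)"
      by (cases rule: cases) (use x(1)[OF k] xj xi in \<open>auto simp: x'_lt x'_j x'_gt intro!: Bochner_Integration.integrable_sum\<close>)
    show "x' k \<in> borel_measurable borel"
    proof -
      have [measurable]: "x j \<in> borel_measurable borel" "x k \<in> borel_measurable borel" using x(3) j k by auto
      have [measurable]: "x i \<in> borel_measurable borel" if "i \<in> {j<..n}" for i using x(3) that j by auto
      show ?thesis by (cases rule: cases) (auto simp: x'_lt x'_j x'_gt)
    qed
    fix s :: real assume s: "s \<in> {0..1}"
    have xj01: "0 \<le> x j s" "x j s \<le> 1" using x(2)[of j s] s j by auto
    show "x' k s \<in> {0..1}"
    proof (cases rule: cases)
      case 1 then show ?thesis using x(2)[OF k s] by (simp add: x'_lt)
    next
      case 2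
      have xi01: "0 \<le> x i s" "x i s \<le> 1" if "i \<in> {j<..n}" for i using x(2)[of i s] s j that by auto
      have "0 \<le> (\<Sum>i\<in>{j<..n}. w i * x i s)" using w0 xi01 by (intro sum_nonneg) simp
      moreover have "(\<Sum>i\<in>{j<..n}. w i * x i s) \<le> W"
        unfolding W_def using w0 xi01 by (intro sum_mono mult_left_le) auto
      moreover have "0 \<le> (1 - W) * x j s" "(1 - W) * x j s \<le> 1 - W"
        using W1 xj01 by (auto intro: mult_left_le)
      ultimately show ?thesis using 2 by (simp add: x'_j)
    next
      case 3
      have "0 \<le> (1 - \<theta> k) * x k s" "(1 - \<theta> k) * x k s \<le> 1 - \<theta> k" "0 \<le> \<theta> k * x j s" "\<theta> k * x j s \<le> \<theta> k"
        using \<theta>[OF 3] x(2)[OF k s] xj01 by (auto intro: mult_left_le)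
      then show ?thesis using 3 by (simp add: x'_gt)
    qed
  next
    fix s
    have "(\<Sum>k=1..n. h k * (x' k s - x k s)) = (\<Sum>k\<in>{j..n}. h k * (x' k s - x k s))"
      using j by (intro sum.mono_neutral_right) (auto simp: x'_lt)
    also have "\<dots> = h j * (x' j s - x j s) + (\<Sum>k\<in>{j<..n}. h k * (x' k s - x k s))"
      unfolding split by simp
    also have "h j * (x' j s - x j s) = (\<Sum>k\<in>{j<..n}. h k * \<theta> k * (x k s - x j s))"
    proof -
      have "x' j s - x j s = (\<Sum>i\<in>{j<..n}. w i * (x i s - x j s))"
        by (simp add: x'_j W_def right_diff_distrib sum_subtractf sum_distrib_right[symmetric] left_diff_distrib)
      then show ?thesis using hj by (simp add: sum_distrib_left w_def)
    qed
    also have "(\<Sum>k\<in>{j<..n}. h k * (x' k s - x k s)) = (\<Sum>k\<in>{j<..n}. - (h k * \<theta> k * (x k s - x j s)))"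
      by (intro sum.cong) (auto simp: x'_gt algebra_simps)
    finally show "(\<Sum>k=1..n. h k * x' k s) = (\<Sum>k=1..n. h k * x k s)"
      by (simp add: sum_negf right_diff_distrib sum_subtractf)
  next
    fix k assume k: "k \<in> {j..n}"
    show "integral\<^sup>L M (x' k) \<le> \<alpha> k"
    proof (cases "k = j")
      case True
      have "integral\<^sup>L M (x' j) = (1 - W) * m j + (\<Sum>i\<in>{j<..n}. w i * m i)"
        unfolding x'_j
      proof (subst Bochner_Integration.integral_add)
        show "integrable M (\<lambda>s. \<Sum>i\<in>{j<..n}. w i * x i s)"
          using xi by (intro Bochner_Integration.integrable_sum integrable_mult_right)
        have "(\<integral>s. (\<Sum>i\<in>{j<..n}. w i * x i s) \<partial>M) = (\<Sum>i\<in>{j<..n}. \<integral>s. w i * x i s \<partial>M)"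
          using xi by (intro Bochner_Integration.integral_sum integrable_mult_right)
        then show "(\<integral>s. (1 - W) * x j s \<partial>M) + (\<integral>s. (\<Sum>i\<in>{j<..n}. w i * x i s) \<partial>M)
            = (1 - W) * m j + (\<Sum>i\<in>{j<..n}. w i * m i)"
          by (simp add: m_def)
      qed (use xj in simp)
      also have "\<dots> = m j - (\<Sum>i\<in>{j<..n}. w i * (m j - m i))"
        by (simp add: W_def right_diff_distrib left_diff_distrib sum_subtractf sum_distrib_right)
      also have "\<dots> = \<alpha> j" using wm hj by simp
      finally show ?thesis using True by simp
    next
      case False
      then have k': "k \<in> {j<..n}" using k by auto
      have "integral\<^sup>L M (x' k) = (1 - \<theta> k) * m k + \<theta> k * m j"
        using k' xj xi by (simp add: x'_gt m_def)
      also have "\<dots> = m k + t * (\<alpha> k - m k)" using \<theta>m[OF k'] by (simp add: algebra_simps)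
      also have "\<dots> \<le> m k + 1 * (\<alpha> k - m k)" using t later'[OF k'] by (intro add_left_mono mult_right_mono) auto
      finally show ?thesis by simp
    qed
  qed (simp_all add: x'_lt)
qed

text \<open>The transfers made so far preserve the weighted total and leave coordinates up to
  \<open>j = n - d\<close> untouched. Hence they preserve the tail sum from \<open>j\<close> on, and
  the tail hypothesis, stated for the initial \<open>x\<close>, is still available when coordinate
  \<open>j\<close> is treated.\<close>

lemma allocation_induction:
  fixes h \<alpha> :: "nat \<Rightarrow> real" and x :: "nat \<Rightarrow> real \<Rightarrow> real"
  assumes h: "\<And>k. k \<in> {1..n} \<Longrightarrow> 0 < h k"
    and \<alpha>: "\<And>j k. 1 \<le> j \<Longrightarrow> j \<le> k \<Longrightarrow> k \<le> n \<Longrightarrow> \<alpha> k \<le> \<alpha> j"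
    and x: "\<And>k. k \<in> {1..n} \<Longrightarrow> integrable M (x k)"
      "\<And>k. k \<in> {1..n} \<Longrightarrow> x k \<in> borel_measurable borel"
      "\<And>k s. k \<in> {1..n} \<Longrightarrow> s \<in> {0..1} \<Longrightarrow> x k s \<in> {0..1}"
    and tail: "\<And>j. 1 \<le> j \<Longrightarrow> j \<le> n \<Longrightarrow> (\<Sum>k=j..n. h k * integral\<^sup>L M (x k)) \<le> (\<Sum>k=j..n. h k * \<alpha> k)"
    and d: "d \<le> n"
  shows "\<exists>x'. (\<forall>k\<in>{1..n}. integrable M (x' k) \<and> x' k \<in> borel_measurable borel \<and> (\<forall>s\<in>{0..1}. x' k s \<in> {0..1}))
    \<and> (\<forall>s. (\<Sum>k=1..n. h k * x' k s) = (\<Sum>k=1..n. h k * x k s))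
    \<and> (\<forall>k\<in>{n-d<..n}. integral\<^sup>L M (x' k) \<le> \<alpha> k) \<and> (\<forall>k\<le>n-d. x' k = x k)"
  using d
proof (induction d)
  case 0
  show ?case by (rule exI[of _ x]) (use x in auto)
next
  case (Suc d)
  define j where "j = n - d"
  have j: "1 \<le> j" "j \<le> n" "n - Suc d = j - 1" using Suc.prems by (auto simp: j_def)
  obtain y where y0: "\<forall>k\<in>{1..n}. integrable M (y k) \<and> y k \<in> borel_measurable borel \<and> (\<forall>s\<in>{0..1}. y k s \<in> {0..1})"
      "\<forall>s. (\<Sum>k=1..n. h k * y k s) = (\<Sum>k=1..n. h k * x k s)"
      "\<forall>k\<in>{j<..n}. integral\<^sup>L M (y k) \<le> \<alpha> k" "\<forall>k\<le>j. y k = x k"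
    using Suc.IH[OF Suc_leD[OF Suc.prems]] unfolding j_def by (elim exE conjE)
  then have y: "\<And>k. k \<in> {1..n} \<Longrightarrow> integrable M (y k)" "\<And>k. k \<in> {1..n} \<Longrightarrow> y k \<in> borel_measurable borel"
      "\<And>k s. k \<in> {1..n} \<Longrightarrow> s \<in> {0..1} \<Longrightarrow> y k s \<in> {0..1}"
      "\<And>s. (\<Sum>k=1..n. h k * y k s) = (\<Sum>k=1..n. h k * x k s)"
      "\<And>k. k \<in> {j<..n} \<Longrightarrow> integral\<^sup>L M (y k) \<le> \<alpha> k" "\<And>k. k \<le> j \<Longrightarrow> y k = x k"
    by blast+
  have total: "(\<Sum>k=1..n. h k * integral\<^sup>L M (y k)) = (\<Sum>k=1..n. h k * integral\<^sup>L M (x k))"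
  proof -
    have "(\<Sum>k=1..n. h k * integral\<^sup>L M (y k)) = (\<integral>s. (\<Sum>k=1..n. h k * y k s) \<partial>M)"
      using y(1) by (subst Bochner_Integration.integral_sum) auto
    also have "\<dots> = (\<Sum>k=1..n. h k * integral\<^sup>L M (x k))"
      unfolding y(4) using x(1) by (subst Bochner_Integration.integral_sum) auto
    finally show ?thesis .
  qed
  have split: "{1..n} = {1..<j} \<union> {j..n}" "{1..<j} \<inter> {j..n} = {}" using j by auto
  have "(\<Sum>k=j..n. h k * integral\<^sup>L M (y k)) = (\<Sum>k=j..n. h k * integral\<^sup>L M (x k))"
    using total unfolding split(1) sum.union_disjoint[OF finite_atLeastLessThan finite_atLeastAtMost split(2)]
    by (simp add: y(6))
  then have tail_y: "(\<Sum>k=j..n. h k * integral\<^sup>L M (y k)) \<le> (\<Sum>k=j..n. h k * \<alpha> k)"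
    using tail[OF j(1,2)] by simp
  have "\<exists>x'. (\<forall>k\<in>{1..n}. integrable M (x' k) \<and> x' k \<in> borel_measurable borel \<and> (\<forall>s\<in>{0..1}. x' k s \<in> {0..1}))
    \<and> (\<forall>s. (\<Sum>k=1..n. h k * x' k s) = (\<Sum>k=1..n. h k * y k s))
    \<and> (\<forall>k\<in>{j..n}. integral\<^sup>L M (x' k) \<le> \<alpha> k) \<and> (\<forall>k<j. x' k = y k)"
    by (rule transfer_excess[OF h \<alpha> j(1,2) y(1,3,2,5) tail_y])
  then obtain x' where x':
    "\<forall>k\<in>{1..n}. integrable M (x' k) \<and> x' k \<in> borel_measurable borel \<and> (\<forall>s\<in>{0..1}. x' k s \<in> {0..1})"
    "\<forall>s. (\<Sum>k=1..n. h k * x' k s) = (\<Sum>k=1..n. h k * y k s)"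
    "\<forall>k\<in>{j..n}. integral\<^sup>L M (x' k) \<le> \<alpha> k" "\<forall>k<j. x' k = y k"
    by (elim exE conjE)
  show ?case
    unfolding j(3)
  proof (intro exI[of _ x'] conjI ballI allI impI)
    fix k assume "k \<le> j - 1"
    then show "x' k = x k" using x'(4) y(6)[of k] j by simp
  next
    fix k assume "k \<in> {j - 1<..n}"
    then show "integral\<^sup>L M (x' k) \<le> \<alpha> k" using x'(3) j by auto
  qed (use x' y(4) in auto)
qed

text \<open>For filling in order, the sum of \<open>h k * x k s\<close> over \<open>k > i\<close>
  telescopes to \<open>max 0 (s - cum_gain h i)\<close> on the unit interval. The hypothesis is
  therefore exactly the bound on tail sums of means from which the transfers start.\<close>

lemma allocation:
  fixes h \<alpha> :: "nat \<Rightarrow> real" and M :: "real measure"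
  assumes h: "\<And>k. k \<in> {1..n} \<Longrightarrow> 0 < h k" and h1: "(\<Sum>k=1..n. h k) = 1"
    and \<alpha>: "\<And>j k. 1 \<le> j \<Longrightarrow> j \<le> k \<Longrightarrow> k \<le> n \<Longrightarrow> \<alpha> k \<le> \<alpha> j"
    and M: "finite_measure M" "sets M = sets borel" "AE s in M. 0 \<le> s \<and> s \<le> 1"
    and tail: "\<And>i. i < n \<Longrightarrow> (\<integral>s. max 0 (s - cum_gain h i) \<partial>M) \<le> (\<Sum>k=i+1..n. h k * \<alpha> k)"
  shows "\<exists>x. (\<forall>k\<in>{1..n}. x k \<in> borel_measurable borel \<and> (\<forall>s\<in>{0..1}. x k s \<in> {0..1}) \<and> (\<integral>s. x k s \<partial>M) \<le> \<alpha> k)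
    \<and> (\<forall>s\<in>{0..1}. (\<Sum>k=1..n. h k * x k s) = s)"
proof -
  interpret finite_measure M by fact
  note M(2)[measurable_cong]
  let ?p = "\<lambda>i s. max 0 (s - cum_gain h i)"
  \<comment> \<open>Equals \<open>(s - cum_gain h (k - 1)) / h k\<close> clamped to the unit
    interval, written as a difference of hinges so that sums telescope.\<close>
  define x where "x k s = (?p (k - 1) s - ?p k s) / h k" for k s
  have cg: "cum_gain h k = cum_gain h (k - 1) + h k" if "k \<in> {1..n}" for k
    using that by (cases k) (auto simp: cum_gain_def)
  have cg0: "cum_gain h 0 = 0" and cgn: "cum_gain h n = 1" using h1 by (auto simp: cum_gain_def)
  have x01: "0 \<le> x k s" "x k s \<le> 1" if k: "k \<in> {1..n}" for k s
    using h[OF k] cg[OF k] by (auto simp: x_def max_def divide_le_eq)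
  have [measurable]: "x k \<in> borel_measurable borel" for k
    unfolding x_def[abs_def] by measurable
  have x_int: "integrable M (x k)" if "k \<in> {1..n}" for k
    using x01[OF that] by (intro integrable_const_bound[where B=1]) auto
  have tail_sum: "(\<Sum>k=j..n. h k * x k s) = ?p (j - 1) s - ?p n s" if j: "1 \<le> j" "j \<le> n" for j s
  proof -
    have "(\<Sum>k=j..n. h k * x k s) = (\<Sum>k=j..n. ?p (k - 1) s - ?p k s)"
    proof (intro sum.cong refl)
      fix k assume "k \<in> {j..n}"
      then have "h k \<noteq> 0" using h[of k] j by auto
      then show "h k * x k s = ?p (k - 1) s - ?p k s" by (simp add: x_def)
    qed
    also have "\<dots> = (\<Sum>k=j..n. (- ?p k s) - (- ?p (k - 1) s))" by simp
    also have "\<dots> = ?p (j - 1) s - ?p n s"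
      using sum_telescope''[of "j - 1" n "\<lambda>k. - ?p k s"] j by simp
    finally show ?thesis .
  qed
  have sum_x: "(\<Sum>k=1..n. h k * x k s) = s" if "s \<in> {0..1}" for s
  proof (cases "n = 0")
    case True then show ?thesis using h1 by simp
  next
    case False then show ?thesis using tail_sum[of 1 s] that cg0 cgn by simp
  qed
  have tails: "(\<Sum>k=j..n. h k * integral\<^sup>L M (x k)) \<le> (\<Sum>k=j..n. h k * \<alpha> k)" if j: "1 \<le> j" "j \<le> n" for j
  proof -
    have "(\<Sum>k=j..n. h k * integral\<^sup>L M (x k)) = (\<integral>s. (\<Sum>k=j..n. h k * x k s) \<partial>M)"
      using x_int j by (subst Bochner_Integration.integral_sum) auto
    also have "\<dots> = (\<integral>s. ?p (j - 1) s \<partial>M)"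
      unfolding tail_sum[OF j] cgn using M(3) by (intro integral_cong_AE) auto
    also have "\<dots> \<le> (\<Sum>k=j..n. h k * \<alpha> k)" using tail[of "j - 1"] j by simp
    finally show ?thesis .
  qed
  have "\<exists>x'. (\<forall>k\<in>{1..n}. integrable M (x' k) \<and> x' k \<in> borel_measurable borel \<and> (\<forall>s\<in>{0..1}. x' k s \<in> {0..1}))
    \<and> (\<forall>s. (\<Sum>k=1..n. h k * x' k s) = (\<Sum>k=1..n. h k * x k s))
    \<and> (\<forall>k\<in>{n-n<..n}. integral\<^sup>L M (x' k) \<le> \<alpha> k) \<and> (\<forall>k\<le>n-n. x' k = x k)"
    by (rule allocation_induction[OF h \<alpha> x_int _ _ tails order_refl]) (simp_all add: x01)
  then  obtain x' where "\<forall>k\<in>{1..n}. integrable M (x' k) \<and> x' k \<in> borel_measurable borel \<and> (\<forall>s\<in>{0..1}. x' k s \<in> {0..1})"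
    "\<forall>s. (\<Sum>k=1..n. h k * x' k s) = (\<Sum>k=1..n. h k * x k s)"
    "\<forall>k\<in>{0<..n}. integral\<^sup>L M (x' k) \<le> \<alpha> k"
    unfolding diff_self_eq_0 by (elim exE conjE)
  then show ?thesis using sum_x by (intro exI[of _ x']) simp
qed

section \<open>The dual problem and its Gibbs law\<close>

text \<open>The hinge at \<open>cum_gain h i\<close> is the share of the output \<open>s\<close>
  carried by the coordinates beyond \<open>i\<close> when inputs are filled in order;
  \<open>lam i\<close> prices its mean.\<close>

definition penalty :: "nat \<Rightarrow> (nat \<Rightarrow> real) \<Rightarrow> (nat \<Rightarrow> real) \<Rightarrow> real \<Rightarrow> real" where
  "penalty n h lam s = (\<Sum>i<n. lam i * max 0 (s - cum_gain h i))"

definition partition_fn :: "nat \<Rightarrow> (nat \<Rightarrow> real) \<Rightarrow> (nat \<Rightarrow> real) \<Rightarrow> real" where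
  "partition_fn n h lam = integral {0..1} (\<lambda>s. exp (- penalty n h lam s))"

text \<open>What remains of \<open>gamma_objective\<close> once \<nu> has been minimised
  out.\<close>

definition dual_objective :: "nat \<Rightarrow> (nat \<Rightarrow> real) \<Rightarrow> (nat \<Rightarrow> real) \<Rightarrow> (nat \<Rightarrow> real) \<Rightarrow> real" where
  "dual_objective n h \<alpha> lam = (\<Sum>i<n. lam i * (\<Sum>k=i+1..n. h k * \<alpha> k)) + ln (partition_fn n h lam)"

section \<open>Closed form of the partition function and elimination of \<nu>\<close>

lemma continuous_on_penalty: "continuous_on A (penalty n h lam)"
  unfolding penalty_def[abs_def] by (intro continuous_intros)

text \<open>The source of the \<open>zeta_fn\<close> factors: one piece of length \<open>d\<close>
  on which the penalty is affine with slope \<open>c\<close>. The value \<open>zeta_fn 0 = 1\<close>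
  covers constant and degenerate pieces.\<close>

lemma has_integral_exp_affine:
  assumes "0 \<le> (d::real)"
  shows "((\<lambda>s. exp (b - c * (s - a))) has_integral (d * exp b * zeta_fn (- c * d))) {a..a + d}"
proof (cases "c * d = 0")
  case True
  have "((\<lambda>s. exp b) has_integral (d * exp b)) {a..a + d}"
    using has_integral_const_real[of "exp b" a "a + d"] assms by simp
  then show ?thesis
  proof (cases "c = 0")
    case False
    then have "d = 0" using True by simp
    then show ?thesis by (simp add: has_integral_refl)
  qed (simp add: zeta_fn_def)
next
  case False
  have "((\<lambda>s. exp (b - c * (s - a))) has_integral (- exp (b - c * (a + d - a)) / c - - exp (b - c * (a - a)) / c)) {a..a + d}"
    using assms False
    by (intro fundamental_theorem_of_calculus)
      (auto intro!: derivative_eq_intros simp: has_real_derivative_iff_has_vector_derivative[symmetric])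
  also have "- exp (b - c * (a + d - a)) / c - - exp (b - c * (a - a)) / c = d * exp b * zeta_fn (- c * d)"
    using False by (simp add: zeta_fn_def exp_diff exp_minus field_simps)
  finally show ?thesis .
qed

locale channel_gains =
  fixes n :: nat and h :: "nat \<Rightarrow> real"
  assumes h: "\<And>k. k \<in> {1..n} \<Longrightarrow> 0 < h k" and h1: "(\<Sum>k=1..n. h k) = 1"
begin

lemma cum_gain_0 [simp]: "cum_gain h 0 = 0"
  by (simp add: cum_gain_def)

lemma cum_gain_Suc: "cum_gain h (Suc k) = cum_gain h k + h (Suc k)"
  by (simp add: cum_gain_def)

lemma cum_gain_mono: "i \<le> j \<Longrightarrow> j \<le> n \<Longrightarrow> cum_gain h i \<le> cum_gain h j"
  unfolding cum_gain_def using h by (intro sum_mono2) (auto intro: less_imp_le)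

lemma cum_gain_bounds: "i \<le> n \<Longrightarrow> 0 \<le> cum_gain h i" "i \<le> n \<Longrightarrow> cum_gain h i \<le> 1"
  using cum_gain_mono[of 0 i] cum_gain_mono[of i n] h1 by (auto simp: cum_gain_def)

lemma cum_gain_less_1: "i < n \<Longrightarrow> cum_gain h i < 1"
  using cum_gain_bounds(2)[of "Suc i"] h[of "Suc i"] by (simp add: cum_gain_Suc)

text \<open>On the \<open>k\<close>-th piece exactly the hinges with \<open>i < k\<close> can be
  nonzero, and each splits as \<open>s - cum_gain h (k - 1)\<close> plus a constant.\<close>

lemma penalty_piece:
  assumes k: "1 \<le> k" "k \<le> n" and s: "cum_gain h (k - 1) \<le> s" "s \<le> cum_gain h k"
  shows "- penalty n h lam s = (- lam 0 * cum_gain h (k - 1) + (\<Sum>i=1..k-2. lam i * (cum_gain h i - cum_gain h (k - 1))))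
     - (\<Sum>i=0..k-1. lam i) * (s - cum_gain h (k - 1))"
proof -
  let ?H = "cum_gain h"
  have "penalty n h lam s = (\<Sum>i<k. lam i * max 0 (s - ?H i))"
    unfolding penalty_def using k s
  proof (intro sum.mono_neutral_right ballI)
    fix i assume "i \<in> {..<n} - {..<k}"
    then show "lam i * max 0 (s - ?H i) = 0" using cum_gain_mono[of k i] s by auto
  qed auto
  also have "\<dots> = (\<Sum>i<k. lam i * (s - ?H (k - 1)) + lam i * (?H (k - 1) - ?H i))"
  proof (intro sum.cong refl)
    fix i assume "i \<in> {..<k}"
    then have "i \<le> k - 1" "k - 1 \<le> n" using k by auto
    then have "?H i \<le> s" using cum_gain_mono[of i "k - 1"] s by linarith
    then show "lam i * max 0 (s - ?H i) = lam i * (s - ?H (k - 1)) + lam i * (?H (k - 1) - ?H i)"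
      by (simp add: max_def algebra_simps)
  qed
  also have "\<dots> = (\<Sum>i<k. lam i) * (s - ?H (k - 1)) + (\<Sum>i<k. lam i * (?H (k - 1) - ?H i))"
    by (simp add: sum.distrib sum_distrib_right)
  also have "(\<Sum>i<k. lam i * (?H (k - 1) - ?H i)) = lam 0 * ?H (k - 1) + (\<Sum>i=1..k-2. lam i * (?H (k - 1) - ?H i))"
  proof -
    \<comment> \<open>The index \<open>k - 1\<close> contributes 0, which is why the sum in the
      exponent stops at \<open>k - 2\<close>; the index 0 is kept apart. For \<open>k = 1\<close>
      the two indices coincide.\<close>
    have "(\<Sum>i<k. lam i * (?H (k - 1) - ?H i)) = (\<Sum>i\<in>insert 0 {1..k-2}. lam i * (?H (k - 1) - ?H i))"
    proof (intro sum.mono_neutral_right ballI)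
      fix i assume i: "i \<in> {..<k} - insert 0 {1..k - 2}"
      then have "i = k - 1" by auto
      then show "lam i * (?H (k - 1) - ?H i) = 0" by simp
    qed (use k in auto)
    then show ?thesis by simp
  qed
  also have "(\<Sum>i=1..k-2. lam i * (?H (k - 1) - ?H i)) = - (\<Sum>i=1..k-2. lam i * (?H i - ?H (k - 1)))"
    by (simp add: sum_negf[symmetric] algebra_simps)
  also have "{..<k} = {0..k-1}" using k by auto
  finally show ?thesis by simp
qed

lemma partition_fn_eq:
  "partition_fn n h lam = (\<Sum>k=1..n. h k
      * exp (- lam 0 * cum_gain h (k - 1) + (\<Sum>i=1..k-2. lam i * (cum_gain h i - cum_gain h (k - 1))))
      * zeta_fn ((- (\<Sum>i=0..k-1. lam i)) * h k))"
proof -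
  let ?H = "cum_gain h"
  let ?e = "\<lambda>s. exp (- penalty n h lam s)"
  let ?t = "\<lambda>k. h k * exp (- lam 0 * ?H (k - 1) + (\<Sum>i=1..k-2. lam i * (?H i - ?H (k - 1))))
      * zeta_fn ((- (\<Sum>i=0..k-1. lam i)) * h k)"
  have "(?e has_integral (\<Sum>k=1..m. ?t k)) {0..?H m}" if "m \<le> n" for m
    using that
  proof (induction m)
    case 0
    show ?case by (simp add: has_integral_refl)
  next
    case (Suc m)
    have m: "?H (Suc m) = ?H m + h (Suc m)" "0 < h (Suc m)" using Suc.prems h[of "Suc m"] cum_gain_Suc[of m] by auto
    have "(?e has_integral ?t (Suc m)) {?H m..?H m + h (Suc m)}"
    proof (rule has_integral_eq)
      show "((\<lambda>s. exp ((- lam 0 * ?H m + (\<Sum>i=1..m-1. lam i * (?H i - ?H m))) - (\<Sum>i=0..m. lam i) * (s - ?H m)))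
          has_integral ?t (Suc m)) {?H m..?H m + h (Suc m)}"
        using has_integral_exp_affine[of "h (Suc m)"] m(2) by (simp add: less_imp_le)
      fix s assume "s \<in> {?H m..?H m + h (Suc m)}"
      then show "exp ((- lam 0 * ?H m + (\<Sum>i=1..m-1. lam i * (?H i - ?H m))) - (\<Sum>i=0..m. lam i) * (s - ?H m)) = ?e s"
        using penalty_piece[of "Suc m" s lam] Suc.prems m by simp
    qed
    then have "(?e has_integral ((\<Sum>k=1..m. ?t k) + ?t (Suc m))) {0..?H (Suc m)}"
      unfolding m(1) using Suc m(2) cum_gain_bounds(1)[of m]
      by (intro has_integral_combine[of 0 "?H m" "?H m + h (Suc m)"]) auto
    then show ?case by simp
  qed
  from this[of n] show ?thesis
    unfolding partition_fn_def using h1 by (simp add: cum_gain_def integral_unique)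
qed

lemma gamma_objective_eq:
  "gamma_objective n h \<alpha> \<nu> lam = (\<Sum>i<n. lam i * (\<Sum>k=i+1..n. h k * \<alpha> k)) - 1 - \<nu> + exp \<nu> * partition_fn n h lam"
proof -
  have "0 < n" using h1 by (cases n) auto
  then have "{0..n - 1} = {..<n}" by auto
  moreover have "lam i * (1 - cum_gain h i) * abar n h \<alpha> i = lam i * (\<Sum>k=i+1..n. h k * \<alpha> k)" if "i < n" for i
    using cum_gain_less_1[OF that] by (simp add: abar_def)
  ultimately have "(\<Sum>i=0..n-1. lam i * (1 - cum_gain h i) * abar n h \<alpha> i) = (\<Sum>i<n. lam i * (\<Sum>k=i+1..n. h k * \<alpha> k))"
    by (intro sum.cong) auto
  then show ?thesis unfolding gamma_objective_def partition_fn_eq by simp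
qed

lemma partition_fn_pos: "0 < partition_fn n h lam"
proof -
  have "(\<lambda>s. exp (- penalty n h lam s)) integrable_on {0..1}"
    by (intro integrable_continuous_real continuous_intros continuous_on_penalty)
  moreover obtain s where s: "s \<in> {0..1}" "\<And>t. t \<in> {0..1} \<Longrightarrow> exp (- penalty n h lam s) \<le> exp (- penalty n h lam t)"
    using continuous_attains_inf[of "{0..1::real}" "\<lambda>s. exp (- penalty n h lam s)"]
    by (force intro!: continuous_intros continuous_on_penalty)
  ultimately have "integral {0..1} (\<lambda>t::real. exp (- penalty n h lam s)) \<le> partition_fn n h lam"
    unfolding partition_fn_def by (intro integral_le) auto
  then have "exp (- penalty n h lam s) \<le> partition_fn n h lam" by simp
  then show ?thesis using exp_gt_zero by (rule less_le_trans[rotated])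
qed

text \<open>With t = \<nu> + ln Z, where Z is the partition function, the part depending on \<nu> is
  ln Z + (exp t - 1 - t); the bracket is nonnegative and vanishes at t = 0.\<close>

lemma gamma_objective_ge: "dual_objective n h \<alpha> lam \<le> gamma_objective n h \<alpha> \<nu> lam"
  and gamma_objective_min: "gamma_objective n h \<alpha> (- ln (partition_fn n h lam)) lam = dual_objective n h \<alpha> lam"
proof -
  have "exp (\<nu> + ln (partition_fn n h lam)) = exp \<nu> * partition_fn n h lam" for \<nu>
    using partition_fn_pos by (simp add: exp_add)
  then show "dual_objective n h \<alpha> lam \<le> gamma_objective n h \<alpha> \<nu> lam"
    "gamma_objective n h \<alpha> (- ln (partition_fn n h lam)) lam = dual_objective n h \<alpha> lam"
    using exp_ge_add_one_self[of "\<nu> + ln (partition_fn n h lam)"] partition_fn_pos[of lam]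
    by (simp_all add: gamma_objective_eq dual_objective_def exp_minus)
qed

end

text \<open>For negative \<open>y\<close> the product (1 - y)(1 + y + y^2) = 1 - y^3 is at least 1,
  and 1 - y \<le> exp (- y). Both signs are needed because multipliers are moved in both
  directions.\<close>

lemma exp_le_quadratic:
  fixes y :: real
  assumes "\<bar>y\<bar> \<le> 1"
  shows "exp y \<le> 1 + y + y\<^sup>2"
proof (cases "0 \<le> y")
  case True
  then show ?thesis using assms exp_bound[of y] by simp
next
  case False
  then have "1 \<le> (1 - y) * (1 + y + y\<^sup>2)"
    by (simp add: algebra_simps power2_eq_square mult_nonneg_nonpos mult_nonpos_nonpos zero_le_mult_iff mult_le_0_iff)
  moreover have "1 - y \<le> exp (- y)" using exp_ge_add_one_self[of "- y"] by simp
  moreover have "0 \<le> 1 + y + y\<^sup>2" using assms by (simp add: abs_le_iff)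
  ultimately have "1 \<le> exp (- y) * (1 + y + y\<^sup>2)"
    by (meson mult_right_mono order_trans)
  then show ?thesis by (simp add: exp_minus divide_simps)
qed

text \<open>Continuity of the partition function in the multipliers is read off its closed form; the
  removable singularity at 0 is the only delicate point there.\<close>

lemma continuous_on_zeta_fn: "continuous_on UNIV zeta_fn"
proof -
  have "isCont zeta_fn x" for x
  proof (cases "x = 0")
    case True
    have "((\<lambda>x. (exp x - 1) / x) \<longlongrightarrow> (1 :: real)) (at 0)" by (rule lim_exp_minus_1)
    then have "(zeta_fn \<longlongrightarrow> 1) (at 0)"
      by (rule Lim_transform_eventually) (auto simp: zeta_fn_def eventually_at_filter)
    then show ?thesis using True by (simp add: isCont_def zeta_fn_def)
  next
    case False
    have "isCont (\<lambda>x. (exp x - 1) / x) x" using False by (intro continuous_intros)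
    moreover have "\<forall>\<^sub>F y in nhds x. zeta_fn y = (exp y - 1) / y"
      using eventually_nhds_in_open[of "- {0}" x] False
      by (auto elim!: eventually_mono simp: zeta_fn_def open_Compl)
    ultimately show ?thesis using isCont_cong by fast
  qed
  then show ?thesis by (simp add: continuous_on_eq_continuous_at)
qed

text \<open>Multipliers are total functions on the naturals, carrying the product topology, so
  compactness is Tychonoff's theorem and every coordinate has to be bounded.\<close>

lemma compact_box_fun:
  fixes M :: "nat \<Rightarrow> real"
  shows "compact {x :: nat \<Rightarrow> real. \<forall>i. x i \<in> {0..M i}}"
proof -
  have "compactin (product_topology (\<lambda>i. euclidean) UNIV) (PiE UNIV (\<lambda>i. {0..M i}))"
    by (simp add: compactin_PiE)
  moreover have "PiE UNIV (\<lambda>i. {0..M i}) = {x. \<forall>i. x i \<in> {0..M i}}" by (auto simp: PiE_def)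
  ultimately show ?thesis by (simp add: euclidean_product_topology)
qed

definition dual_optimal :: "nat \<Rightarrow> (nat \<Rightarrow> real) \<Rightarrow> (nat \<Rightarrow> real) \<Rightarrow> (nat \<Rightarrow> real) \<Rightarrow> bool" where
  "dual_optimal n h \<alpha> lam \<longleftrightarrow> (\<forall>i<n. 0 \<le> lam i) \<and>
    (\<forall>lam'. (\<forall>i<n. 0 \<le> lam' i) \<longrightarrow> dual_objective n h \<alpha> lam \<le> dual_objective n h \<alpha> lam')"

section \<open>Existence of an optimal multiplier\<close>

context channel_gains
begin

lemma continuous_on_dual_objective: "continuous_on A (dual_objective n h \<alpha>)"
proof -
  have coord: "continuous_on UNIV (\<lambda>lam :: nat \<Rightarrow> real. lam i)" for i by simp
  have "continuous_on UNIV (partition_fn n h)"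
    unfolding partition_fn_eq[abs_def]
    by (intro continuous_intros coord continuous_on_compose2[OF continuous_on_zeta_fn]) auto
  then have "continuous_on UNIV (dual_objective n h \<alpha>)"
    unfolding dual_objective_def[abs_def]
    using partition_fn_pos by (intro continuous_intros coord) (auto simp: less_imp_neq[symmetric])
  then show ?thesis by (rule continuous_on_subset) simp
qed

text \<open>Coercivity: near 0 only the multiplier with index 0 acts, so the logarithm of the
  partition function falls at most like \<open>- lam 0 * \<epsilon>\<close>, and half of the linear
  term pays for that. The other half grows in every multiplier, and a compact box suffices.\<close>

lemma dual_optimal_exists:
  assumes c: "\<And>i. i < n \<Longrightarrow> 0 < (\<Sum>k=i+1..n. h k * \<alpha> k)"
  shows "\<exists>lam. dual_optimal n h \<alpha> lam"
proof -
  let ?c = "\<lambda>i. \<Sum>k=i+1..n. h k * \<alpha> k"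
  have n: "0 < n" using h1 by (cases n) auto
  \<comment> \<open>At most \<open>h 1\<close>, so that no hinge other than the first is active on
    [0, \<epsilon>]; at most half of \<open>?c 0\<close>, so that half of the linear term
    remains.\<close>
  define \<epsilon> where "\<epsilon> = min (h 1) (?c 0 / 2)"
  have \<epsilon>: "0 < \<epsilon>" "\<epsilon> \<le> h 1" "\<epsilon> \<le> ?c 0 / 2" using h[of 1] c[of 0] n by (auto simp: \<epsilon>_def)
  have h_le: "h 1 \<le> 1" using cum_gain_bounds(2)[of 1] n by (simp add: cum_gain_def)
  have coercive: "(\<Sum>i<n. lam i * ?c i / 2) + ln \<epsilon> \<le> dual_objective n h \<alpha> lam" if lam: "\<And>i. i < n \<Longrightarrow> 0 \<le> lam i" for lam
  proof -
    have pen: "penalty n h lam s \<le> lam 0 * \<epsilon>" if s: "s \<in> {0..\<epsilon>}" for s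
    proof -
      have "penalty n h lam s = (\<Sum>i\<in>{0}. lam i * max 0 (s - cum_gain h i))"
        unfolding penalty_def
      proof (intro sum.mono_neutral_right ballI)
        fix i assume "i \<in> {..<n} - {0}"
        then have "h 1 \<le> cum_gain h i" using cum_gain_mono[of 1 i] by (simp add: cum_gain_def)
        then have "s \<le> cum_gain h i" using s \<epsilon> by simp
        then show "lam i * max 0 (s - cum_gain h i) = 0" by simp
      qed (use n in auto)
      also have "\<dots> \<le> lam 0 * \<epsilon>" using s lam[of 0] n by (auto simp: cum_gain_def intro!: mult_left_mono)
      finally show ?thesis .
    qed
    have integ: "(\<lambda>s. exp (- penalty n h lam s)) integrable_on {0..a}" for a
      by (intro integrable_continuous_real continuous_intros continuous_on_penalty)
    have "\<epsilon> * exp (- lam 0 * \<epsilon>) = integral {0..\<epsilon>} (\<lambda>s. exp (- lam 0 * \<epsilon>))" using \<epsilon> by simp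
    also have "\<dots> \<le> integral {0..\<epsilon>} (\<lambda>s. exp (- penalty n h lam s))"
      using pen integ by (intro integral_le) auto
    also have "\<dots> \<le> partition_fn n h lam"
      unfolding partition_fn_def using \<epsilon> h_le integ by (intro integral_subset_le) auto
    finally have "ln (\<epsilon> * exp (- lam 0 * \<epsilon>)) \<le> ln (partition_fn n h lam)"
      using \<epsilon> by (intro ln_mono) auto
    then have "ln \<epsilon> - lam 0 * \<epsilon> \<le> ln (partition_fn n h lam)" using \<epsilon> by (simp add: ln_mult_pos)
    moreover have "lam 0 * \<epsilon> \<le> (\<Sum>i<n. lam i * ?c i / 2)"
    proof -
      have "lam 0 * \<epsilon> \<le> lam 0 * ?c 0 / 2" using mult_left_mono[OF \<epsilon>(3) lam[of 0]] n by simp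
      also have "\<dots> \<le> (\<Sum>i<n. lam i * ?c i / 2)"
        using member_le_sum[of 0 "{..<n}" "\<lambda>i. lam i * ?c i / 2"] n lam c by (simp add: less_imp_le)
      finally show ?thesis .
    qed
    ultimately show ?thesis
      unfolding dual_objective_def by (simp add: sum_divide_distrib[symmetric])
  qed
  \<comment> \<open>The value of \<open>lam i\<close> at which
    \<open>lam i * ?c i / 2 + ln \<epsilon>\<close> reaches 0, the value of the objective at the
    zero multiplier. Indices from \<open>n\<close> on are pinned to 0, which does not affect the
    objective and makes the box compact.\<close>
  define M where "M i = (if i < n then - 2 * ln \<epsilon> / ?c i else 0)" for i
  let ?K = "{x :: nat \<Rightarrow> real. \<forall>i. x i \<in> {0..M i}}"
  have "ln \<epsilon> \<le> 0" using \<epsilon> h_le by simp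
  then have M0: "0 \<le> M i" for i using c[of i] by (auto simp: M_def divide_nonpos_pos)
  have zero: "(\<lambda>_. 0) \<in> ?K" using M0 by simp
  have zero_val: "dual_objective n h \<alpha> (\<lambda>_. 0) = 0"
    by (simp add: dual_objective_def partition_fn_def penalty_def)
  obtain lam where lam: "lam \<in> ?K" "\<And>lam'. lam' \<in> ?K \<Longrightarrow> dual_objective n h \<alpha> lam \<le> dual_objective n h \<alpha> lam'"
  proof -
    have "?K \<noteq> {}" using zero by (metis emptyE)
    from continuous_attains_inf[OF compact_box_fun this continuous_on_dual_objective]
    obtain l where "l \<in> ?K" "\<forall>y\<in>?K. dual_objective n h \<alpha> l \<le> dual_objective n h \<alpha> y" by (rule bexE)
    then show ?thesis by (intro that[of l]) (assumption, erule (1) bspec)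
  qed
  show ?thesis
    unfolding dual_optimal_def
  proof (intro exI[of _ lam] conjI allI impI)
    show "0 \<le> lam i" for i using lam(1) by simp
    fix lam' :: "nat \<Rightarrow> real" assume "\<forall>i<n. 0 \<le> lam' i"
    then have lam': "\<And>i. i < n \<Longrightarrow> 0 \<le> lam' i" by blast
    show "dual_objective n h \<alpha> lam \<le> dual_objective n h \<alpha> lam'"
    proof (cases "\<forall>i<n. lam' i \<le> M i")
      case True
      let ?l = "\<lambda>i. if i < n then lam' i else 0"
      have "?l \<in> ?K" using True lam' by (auto simp: M_def)
      then have "dual_objective n h \<alpha> lam \<le> dual_objective n h \<alpha> ?l" by (rule lam(2))
      also have "dual_objective n h \<alpha> ?l = dual_objective n h \<alpha> lam'"
        by (simp add: dual_objective_def partition_fn_def penalty_def)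
      finally show ?thesis .
    next
      case False
      then obtain i where i: "i < n" "M i < lam' i" by (auto simp: not_le)
      then have "- 2 * ln \<epsilon> / ?c i * ?c i < lam' i * ?c i"
        using c[OF i(1)] by (intro mult_strict_right_mono) (simp_all add: M_def)
      then have "0 < lam' i * ?c i / 2 + ln \<epsilon>"
        using c[OF i(1)] by simp
      also have "\<dots> \<le> (\<Sum>i<n. lam' i * ?c i / 2) + ln \<epsilon>"
        using member_le_sum[of i "{..<n}" "\<lambda>i. lam' i * ?c i / 2"] i lam' c by (simp add: less_imp_le)
      also have "\<dots> \<le> dual_objective n h \<alpha> lam'" by (rule coercive[OF lam'])
      finally have "0 < dual_objective n h \<alpha> lam'" by simp
      moreover have "dual_objective n h \<alpha> lam \<le> 0" using lam(2)[OF zero] zero_val by simp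
      ultimately show ?thesis by simp
    qed
  qed
qed

end

section \<open>The Gibbs law and its first-order conditions\<close>

lemma sum_fun_upd_add:
  fixes lam w :: "nat \<Rightarrow> real"
  assumes "i < n"
  shows "(\<Sum>j<n. (lam(i := lam i + t)) j * w j) = (\<Sum>j<n. lam j * w j) + t * w i"
proof -
  have "(\<Sum>j<n. (lam(i := lam i + t)) j * w j) = (\<Sum>j<n. lam j * w j + (if j = i then t * w i else 0))"
    by (intro sum.cong) (auto simp: distrib_right)
  then show ?thesis using assms by (simp add: sum.distrib)
qed

context channel_gains
begin

text \<open>Not cut off outside the unit interval: the transport needs a function that is positive
  and continuous on the whole line, and the restriction is made in \<open>gibbs_law\<close>.\<close>

definition gibbs_density :: "(nat \<Rightarrow> real) \<Rightarrow> real \<Rightarrow> real" where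
  "gibbs_density lam s = exp (- penalty n h lam s) / partition_fn n h lam"

definition gibbs_law :: "(nat \<Rightarrow> real) \<Rightarrow> real measure" where
  "gibbs_law lam = density lborel (\<lambda>s. ennreal (gibbs_density lam s * indicator {0..1} s))"

lemma continuous_on_gibbs_density: "continuous_on A (gibbs_density lam)"
  unfolding gibbs_density_def[abs_def] using partition_fn_pos[of lam]
  by (intro continuous_intros continuous_on_penalty) auto

lemma gibbs_density_pos: "0 < gibbs_density lam s"
  using partition_fn_pos[of lam] by (simp add: gibbs_density_def)

lemma measurable_gibbs_density [measurable]: "gibbs_density lam \<in> borel_measurable borel"
  by (rule borel_measurable_continuous_onI[OF continuous_on_gibbs_density])

lemma integral_gibbs_law:
  assumes "continuous_on UNIV \<phi>"
  shows "integrable (gibbs_law lam) \<phi>"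
    and "(\<integral>s. \<phi> s \<partial>gibbs_law lam) = integral {0..1} (\<lambda>s. gibbs_density lam s * \<phi> s)"
proof -
  have [measurable]: "\<phi> \<in> borel_measurable borel"
    using assms by (rule borel_measurable_continuous_onI)
  have cont: "continuous_on {0..1} (\<lambda>s. gibbs_density lam s * \<phi> s)"
    by (intro continuous_intros continuous_on_gibbs_density continuous_on_subset[OF assms]) auto
  then have set: "set_integrable lborel {0..1} (\<lambda>s. gibbs_density lam s * \<phi> s)"
    by (rule borel_integrable_atLeastAtMost')
  have eq: "gibbs_density lam s * indicator {0..1} s * \<phi> s = indicator {0..1} s *\<^sub>R (gibbs_density lam s * \<phi> s)" for s
    by simp
  show "integrable (gibbs_law lam) \<phi>"
    unfolding gibbs_law_def using set gibbs_density_pos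
    by (subst integrable_real_density) (auto simp: eq set_integrable_def less_imp_le)
  have "(\<integral>s. \<phi> s \<partial>gibbs_law lam) = (LINT s:{0..1}|lborel. gibbs_density lam s * \<phi> s)"
    unfolding gibbs_law_def using gibbs_density_pos
    by (subst integral_real_density) (auto simp: eq set_lebesgue_integral_def less_imp_le)
  also have "\<dots> = integral {0..1} (\<lambda>s. gibbs_density lam s * \<phi> s)"
    using set by (rule set_borel_integral_eq_integral(2))
  finally show "(\<integral>s. \<phi> s \<partial>gibbs_law lam) = integral {0..1} (\<lambda>s. gibbs_density lam s * \<phi> s)" .
qed

lemma prob_space_gibbs_law: "prob_space (gibbs_law lam)"
proof
  have int1: "integrable (gibbs_law lam) (\<lambda>_. 1 :: real)" "(\<integral>s. 1 \<partial>gibbs_law lam) = (1 :: real)"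
    using integral_gibbs_law[of "\<lambda>_. 1" lam] partition_fn_pos[of lam]
    by (auto simp: gibbs_density_def partition_fn_def)
  have "emeasure (gibbs_law lam) (space (gibbs_law lam)) = (\<integral>\<^sup>+s. ennreal 1 \<partial>gibbs_law lam)" by simp
  also have "\<dots> = 1" using int1 by (subst nn_integral_eq_integral) auto
  finally show "emeasure (gibbs_law lam) (space (gibbs_law lam)) = 1" .
qed

lemma sets_gibbs_law [simp, measurable_cong]: "sets (gibbs_law lam) = sets borel"
  by (simp add: gibbs_law_def)

lemma AE_gibbs_law: "AE s in gibbs_law lam. 0 \<le> s \<and> s \<le> 1"
  unfolding gibbs_law_def by (subst AE_density) (auto simp: indicator_def)

lemma penalty_update:
  "i < n \<Longrightarrow> penalty n h (lam(i := lam i + t)) s = penalty n h lam s + t * max 0 (s - cum_gain h i)"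
  unfolding penalty_def by (rule sum_fun_upd_add)

text \<open>The ratio of the new to the old partition function is the Gibbs mean of exp (- t p) with
  a hinge p in [0,1], hence at most 1 - t E p + t^2; then ln x \<le> x - 1. This one-sided expansion
  replaces the derivative of the objective.\<close>

lemma dual_objective_update_le:
  assumes i: "i < n" and t: "\<bar>t\<bar> \<le> 1"
  shows "dual_objective n h \<alpha> (lam(i := lam i + t)) \<le> dual_objective n h \<alpha> lam
    + t * ((\<Sum>k=i+1..n. h k * \<alpha> k) - (\<integral>s. max 0 (s - cum_gain h i) \<partial>gibbs_law lam)) + t\<^sup>2"
proof -
  let ?Z = "partition_fn n h" and ?lam' = "lam(i := lam i + t)"
  define p where "p s = max 0 (s - cum_gain h i)" for s
  have cont_p: "continuous_on A p" for A unfolding p_def by (intro continuous_intros)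
  interpret prob_space "gibbs_law lam" by (rule prob_space_gibbs_law)
  have "?Z ?lam' / ?Z lam = integral {0..1} (\<lambda>s. gibbs_density lam s * exp (- t * p s))"
    unfolding partition_fn_def[of n h ?lam'] penalty_update[OF i] gibbs_density_def p_def
    by (simp add: exp_add exp_diff exp_minus divide_inverse mult_ac flip: integral_mult_right)
  also have "\<dots> = (\<integral>s. exp (- t * p s) \<partial>gibbs_law lam)"
    by (intro integral_gibbs_law(2)[symmetric] continuous_intros cont_p)
  also have "\<dots> \<le> (\<integral>s. 1 - t * p s + t\<^sup>2 \<partial>gibbs_law lam)"
  proof (rule integral_mono_AE)
    show "integrable (gibbs_law lam) (\<lambda>s. exp (- t * p s))"
      by (intro integral_gibbs_law(1) continuous_intros cont_p)
    show "integrable (gibbs_law lam) (\<lambda>s. 1 - t * p s + t\<^sup>2)"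
      by (intro integral_gibbs_law(1) continuous_intros cont_p)
    show "AE s in gibbs_law lam. exp (- t * p s) \<le> 1 - t * p s + t\<^sup>2"
      using AE_gibbs_law
    proof eventually_elim
      fix s :: real assume "0 \<le> s \<and> s \<le> 1"
      then have p: "0 \<le> p s" "p s \<le> 1" using cum_gain_bounds[of i] i by (auto simp: p_def)
      have le: "\<bar>t * p s\<bar> \<le> \<bar>t\<bar>" using p by (simp add: abs_mult mult_left_le)
      then have "\<bar>- (t * p s)\<bar> \<le> 1" using t by linarith
      from exp_le_quadratic[OF this] have "exp (- t * p s) \<le> 1 - t * p s + (t * p s)\<^sup>2" by simp
      moreover have "(t * p s)\<^sup>2 \<le> t\<^sup>2" using le by (simp add: abs_le_square_iff)
      ultimately show "exp (- t * p s) \<le> 1 - t * p s + t\<^sup>2" by simp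
    qed
  qed
  also have "\<dots> = 1 - t * (\<integral>s. p s \<partial>gibbs_law lam) + t\<^sup>2"
    using integral_gibbs_law(1)[OF cont_p, of lam] prob_space by simp
  finally have "?Z ?lam' / ?Z lam - 1 \<le> - t * (\<integral>s. p s \<partial>gibbs_law lam) + t\<^sup>2" by simp
  moreover have "ln (?Z ?lam') - ln (?Z lam) \<le> ?Z ?lam' / ?Z lam - 1"
    using ln_le_minus_one[of "?Z ?lam' / ?Z lam"] partition_fn_pos[of lam] partition_fn_pos[of ?lam']
    by (simp add: ln_divide_pos)
  moreover have "(\<Sum>j<n. ?lam' j * (\<Sum>k=j+1..n. h k * \<alpha> k)) = (\<Sum>j<n. lam j * (\<Sum>k=j+1..n. h k * \<alpha> k)) + t * (\<Sum>k=i+1..n. h k * \<alpha> k)"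
    using i by (rule sum_fun_upd_add)
  ultimately show ?thesis
    unfolding dual_objective_def p_def by (simp add: right_diff_distrib)
qed

text \<open>Raising a multiplier is always feasible, and dividing by the small step gives
  \<open>m \<le> c\<close>. Lowering it is feasible when it is positive and gives the converse,
  hence complementary slackness.\<close>

lemma dual_objective_kkt:
  assumes opt: "dual_optimal n h \<alpha> lam"
    and i: "i < n"
  defines "m \<equiv> \<integral>s. max 0 (s - cum_gain h i) \<partial>gibbs_law lam" and "c \<equiv> \<Sum>k=i+1..n. h k * \<alpha> k"
  shows "m \<le> c" and "lam i * m = lam i * c"
proof -
  have nonneg: "\<And>i. i < n \<Longrightarrow> 0 \<le> lam i" using opt by (simp add: dual_optimal_def)
  have step: "0 \<le> t * (c - m) + t\<^sup>2" if "\<bar>t\<bar> \<le> 1" "0 \<le> lam i + t" for t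
  proof -
    have "dual_objective n h \<alpha> lam \<le> dual_objective n h \<alpha> (lam(i := lam i + t))"
    proof -
      have "\<forall>j<n. 0 \<le> (lam(i := lam i + t)) j" using nonneg that(2) by simp
      then show ?thesis using opt unfolding dual_optimal_def by blast
    qed
    then show ?thesis
      using dual_objective_update_le[OF i that(1), of \<alpha> lam] unfolding m_def c_def by linarith
  qed
  show "m \<le> c"
  proof (rule field_le_epsilon)
    fix e :: real assume e: "0 < e"
    define t where "t = min e 1"
    have t: "0 < t" "t \<le> e" "t \<le> 1" using e by (auto simp: t_def)
    then have "0 \<le> t * (c - m + t)" using step[of t] nonneg[OF i] by (simp add: power2_eq_square distrib_left)
    then show "m \<le> c + e" using t by (simp add: zero_le_mult_iff)
  qed
  moreover have "c \<le> m" if pos: "0 < lam i"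
  proof (rule field_le_epsilon)
    fix e :: real assume e: "0 < e"
    \<comment> \<open>The bound by \<open>lam i\<close> keeps the lowered multiplier
      nonnegative.\<close>
    define t where "t = min (min e 1) (lam i)"
    have t: "0 < t" "t \<le> e" "t \<le> 1" "t \<le> lam i" using e pos by (auto simp: t_def)
    then have "0 \<le> t * (m - c + t)" using step[of "- t"] by (simp add: power2_eq_square algebra_simps)
    then show "c \<le> m + e" using t by (simp add: zero_le_mult_iff)
  qed
  ultimately show "lam i * m = lam i * c" using nonneg[OF i] by (cases "lam i = 0") auto
qed

text \<open>The negative log density is the penalty plus the logarithm of the partition function;
  complementary slackness turns the mean penalty into the linear term of the dual objective.\<close>

lemma gibbs_entropy:
  assumes opt: "dual_optimal n h \<alpha> lam"
  shows "- (\<integral>s. ln (gibbs_density lam s) \<partial>gibbs_law lam) = dual_objective n h \<alpha> lam"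
proof -
  interpret prob_space "gibbs_law lam" by (rule prob_space_gibbs_law)
  have ln: "ln (gibbs_density lam s) = - penalty n h lam s - ln (partition_fn n h lam)" for s
    using partition_fn_pos[of lam] by (simp add: gibbs_density_def ln_divide_pos)
  have p: "integrable (gibbs_law lam) (\<lambda>s. max 0 (s - cum_gain h i))" for i
    by (intro integral_gibbs_law(1) continuous_intros)
  have "(\<integral>s. penalty n h lam s \<partial>gibbs_law lam) = (\<Sum>i<n. lam i * (\<integral>s. max 0 (s - cum_gain h i) \<partial>gibbs_law lam))"
    unfolding penalty_def using p by (subst Bochner_Integration.integral_sum) auto
  also have "\<dots> = (\<Sum>i<n. lam i * (\<Sum>k=i+1..n. h k * \<alpha> k))"
    using dual_objective_kkt(2)[OF opt] by (intro sum.cong) auto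
  finally show ?thesis
    using integral_gibbs_law(1)[OF continuous_on_penalty, of lam n h lam] prob_space
    by (simp add: ln dual_objective_def)
qed

end

section \<open>The capacity bound\<close>

text \<open>The input is a deterministic function of S, so its law is a push-forward of
  \<open>\<mu>\<close> concentrated on a curve in the cube, and its weighted sum returns S.\<close>

lemma (in unit_law) channel_information_le_capacity:
  fixes h \<alpha> :: "nat \<Rightarrow> real" and x :: "nat \<Rightarrow> real \<Rightarrow> real"
  assumes x: "\<And>k. k \<in> {1..n} \<Longrightarrow> x k \<in> borel_measurable borel"
      "\<And>k s. k \<in> {1..n} \<Longrightarrow> s \<in> {0..1} \<Longrightarrow> x k s \<in> {0..1}"
      "\<And>s. s \<in> {0..1} \<Longrightarrow> (\<Sum>k=1..n. h k * x k s) = s"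
      "\<And>k. k \<in> {1..n} \<Longrightarrow> (\<integral>s. x k s \<partial>\<mu>) \<le> \<alpha> k"
  shows "ereal (\<integral>p. ln (normal_density 0 \<sigma> (snd p) / g (fst p + snd p)) \<partial>(\<mu> \<Otimes>\<^sub>M gaussian_noise \<sigma>))
    \<le> bc_oic_capacity n h \<alpha> \<sigma>"
proof -
  define X where "X s = (\<lambda>k\<in>{1..n}. x k s)" for s
  have X [measurable]: "X \<in> measurable \<mu> (input_space n)"
    unfolding X_def[abs_def] using x(1) by (intro measurable_restrict) (simp add: measurable_cong_sets[OF sets_mu refl])
  define P where "P = distr \<mu> (input_space n) X"
  have P: "prob_space P" "sets P = sets (input_space n)"
    unfolding P_def by (rule prob_space_distr[OF X]) simp
  have Pi_meas: "(\<lambda>v. v k) \<in> borel_measurable (input_space n)" if "k \<in> {1..n}" for k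
    using that by (rule measurable_component_singleton)
  have "distr P borel (\<lambda>v. \<Sum>k=1..n. h k * v k) = distr \<mu> borel (\<lambda>s. \<Sum>k=1..n. h k * X s k)"
    unfolding P_def using X Pi_meas by (subst distr_distr) (auto simp: comp_def)
  also have "\<dots> = distr \<mu> borel (\<lambda>s. s)"
  proof (rule distr_cong_AE)
    show "AE s in \<mu>. (\<Sum>k=1..n. h k * X s k) = s"
      using AE_unit by eventually_elim (use x(3) in \<open>simp add: X_def\<close>)
    show "(\<lambda>s. \<Sum>k=1..n. h k * X s k) \<in> borel_measurable \<mu>"
      using x(1) by (auto simp: X_def measurable_cong_sets[OF sets_mu refl])
  qed auto
  also have "\<dots> = \<mu>" by (rule distr_id2[OF sets_mu[symmetric]])
  finally have law: "distr P borel (\<lambda>v. \<Sum>k=1..n. h k * v k) = \<mu>" .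
  have "P \<in> admissible_laws n \<alpha>"
    unfolding admissible_laws_def
  proof (intro CollectI conjI P ballI)
    fix k assume k: "k \<in> {1..n}"
    have Xk: "X s k = x k s" for s using k by (simp add: X_def)
    note [measurable] = Pi_meas[OF k]
    have "AE s in \<mu>. 0 \<le> X s k \<and> X s k \<le> 1"
      using AE_unit by eventually_elim (use x(2)[OF k] in \<open>simp add: Xk\<close>)
    moreover have "{v \<in> space (input_space n). 0 \<le> v k \<and> v k \<le> 1} \<in> sets (input_space n)"
      by measurable
    ultimately show "AE v in P. 0 \<le> v k \<and> v k \<le> 1"
      unfolding P_def by (rule AE_distr_iff[OF X, THEN iffD2, rotated])
    have "(\<integral>v. v k \<partial>P) = (\<integral>s. X s k \<partial>\<mu>)"
      unfolding P_def by (rule integral_distr[OF X Pi_meas[OF k]])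
    then show "(\<integral>v. v k \<partial>P) \<le> \<alpha> k" using x(4)[OF k] by (simp add: Xk)
  qed
  then have "ereal (channel_information n h \<sigma> P) \<le> bc_oic_capacity n h \<alpha> \<sigma>"
    unfolding bc_oic_capacity_def by (rule SUP_upper)
  then show ?thesis unfolding channel_information_eq[OF P law] .
qed

theorem theorem4:
  fixes n :: nat and h \<alpha> :: "nat \<Rightarrow> real" and \<sigma> :: real
  assumes "2 \<le> n"
    and "\<forall>k\<in>{1..n}. 0 < h k"
    and "(\<Sum>k=1..n. h k) = 1"
    and "\<alpha> 1 \<le> 1"
    and "\<forall>k\<in>{1..<n}. \<alpha> (Suc k) < \<alpha> k"
    and "0 < \<alpha> n"
    and "\<alpha> n \<le> 1 / 2"
    and "0 < \<sigma>"
  shows "gamma_B n h \<alpha> \<in> gamma_values n h \<alpha> \<and>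
         (\<forall>v \<in> gamma_values n h \<alpha>. gamma_B n h \<alpha> \<le> v) \<and>
         bc_oic_capacity n h \<alpha> \<sigma> \<ge>
           ereal (1 / 2 * ln (1 + exp (2 * gamma_B n h \<alpha>) / (2 * pi * exp 1 * \<sigma>\<^sup>2)))"
proof -
  interpret channel_gains n h using assms(2,3) by unfold_locales auto
  have \<alpha>_anti: "\<alpha> k \<le> \<alpha> j" if "1 \<le> j" "j \<le> k" "k \<le> n" for j k
    using that(2,3)
  proof (induction k rule: dec_induct)
    case (step i)
    then have "\<alpha> (Suc i) < \<alpha> i" using assms(5) that(1) by simp
    then show ?case using step by simp
  qed simp
  \<comment> \<open>Positivity of the smallest bound, \<open>\<alpha> n\<close>, makes every linear
    coefficient of the dual positive, which is what coercivity requires.\<close>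
  have slack: "0 < (\<Sum>k=i+1..n. h k * \<alpha> k)" if "i < n" for i
  proof (rule sum_pos)
    fix k assume k: "k \<in> {i + 1..n}"
    then have "0 < \<alpha> k" using \<alpha>_anti[of k n] assms(6) by simp
    then show "0 < h k * \<alpha> k" using h[of k] k by simp
  qed (use that in auto)
  obtain lam where opt: "dual_optimal n h \<alpha> lam" using dual_optimal_exists[OF slack] by auto
  have index: "{0..n - 1} = {..<n}" using assms(1) by auto
  have mem: "dual_objective n h \<alpha> lam \<in> gamma_values n h \<alpha>"
    unfolding gamma_values_def index
  proof (intro CollectI exI conjI)
    show "dual_objective n h \<alpha> lam = gamma_objective n h \<alpha> (- ln (partition_fn n h lam)) lam"
      by (rule gamma_objective_min[symmetric])
  qed (use opt in \<open>simp add: dual_optimal_def\<close>)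
  have lower: "dual_objective n h \<alpha> lam \<le> v" if v: "v \<in> gamma_values n h \<alpha>" for v
  proof -
    obtain \<nu> lam' where "v = gamma_objective n h \<alpha> \<nu> lam'" "\<forall>i\<in>{..<n}. 0 \<le> lam' i"
      using v unfolding gamma_values_def index by auto
    moreover from this have "dual_objective n h \<alpha> lam \<le> dual_objective n h \<alpha> lam'"
      using opt unfolding dual_optimal_def by blast
    ultimately show ?thesis using gamma_objective_ge[of \<alpha> lam' \<nu>] by linarith
  qed
  have \<gamma>: "gamma_B n h \<alpha> = dual_objective n h \<alpha> lam"
    unfolding gamma_B_def using mem lower by (rule cInf_eq_minimum)
  interpret S: unit_law "gibbs_law lam" \<sigma>
    using prob_space_gibbs_law AE_gibbs_law assms(8)
    by (intro unit_law.intro unit_law_axioms.intro) auto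
  have tails: "(\<integral>s. max 0 (s - cum_gain h i) \<partial>gibbs_law lam) \<le> (\<Sum>k=i+1..n. h k * \<alpha> k)" if "i < n" for i
    by (rule dual_objective_kkt(1)[OF opt that])
  have "\<exists>x. (\<forall>k\<in>{1..n}. x k \<in> borel_measurable borel \<and> (\<forall>s\<in>{0..1}. x k s \<in> {0..1})
        \<and> (\<integral>s. x k s \<partial>gibbs_law lam) \<le> \<alpha> k) \<and> (\<forall>s\<in>{0..1}. (\<Sum>k=1..n. h k * x k s) = s)"
    by (rule allocation[OF h h1 \<alpha>_anti S.finite_measure_axioms sets_gibbs_law AE_gibbs_law tails])
  then obtain x where x: "\<forall>k\<in>{1..n}. x k \<in> borel_measurable borel \<and> (\<forall>s\<in>{0..1}. x k s \<in> {0..1})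
        \<and> (\<integral>s. x k s \<partial>gibbs_law lam) \<le> \<alpha> k" "\<forall>s\<in>{0..1}. (\<Sum>k=1..n. h k * x k s) = s"
    by (elim exE conjE)
  have "- (\<integral>s. ln (gibbs_density lam s) \<partial>gibbs_law lam) = gamma_B n h \<alpha>"
    unfolding \<gamma> by (rule gibbs_entropy[OF opt])
  with S.smoothed_entropy_bound[OF continuous_on_gibbs_density gibbs_density_pos gibbs_law_def]
  have "1 / 2 * ln (1 + exp (2 * gamma_B n h \<alpha>) / (2 * pi * exp 1 * \<sigma>\<^sup>2))
    \<le> (\<integral>p. ln (normal_density 0 \<sigma> (snd p) / S.g (fst p + snd p)) \<partial>(gibbs_law lam \<Otimes>\<^sub>M gaussian_noise \<sigma>))"
    by (simp only:)
  then have "ereal (1 / 2 * ln (1 + exp (2 * gamma_B n h \<alpha>) / (2 * pi * exp 1 * \<sigma>\<^sup>2)))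
    \<le> ereal (\<integral>p. ln (normal_density 0 \<sigma> (snd p) / S.g (fst p + snd p)) \<partial>(gibbs_law lam \<Otimes>\<^sub>M gaussian_noise \<sigma>))"
    by (simp only: ereal_less_eq)
  also have "\<dots> \<le> bc_oic_capacity n h \<alpha> \<sigma>"
    by (rule S.channel_information_le_capacity[where x=x]) (use x in blast)+
  finally have "ereal (1 / 2 * ln (1 + exp (2 * gamma_B n h \<alpha>) / (2 * pi * exp 1 * \<sigma>\<^sup>2))) \<le> bc_oic_capacity n h \<alpha> \<sigma>" .
  then show ?thesis using mem lower unfolding \<gamma> by blast
qed

end
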